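(* For every integer $d\ge 69$ there exists an infinite family of $d$-dimensional convex polytopes $P_n$, $n\ge 1$, such that $P_n$ has exactly $12(n+1)+60+d$ vertices (so the $P_n$ are pairwise combinatorially distinct) and every $P_n$ is projectively unique.
   Context: A $d$-polytope $P$ (in $\mathbb{R}^d$, or equivalently a spherical polytope in an open hemisphere of $S^d$) is projectively unique if the group $\mathrm{PGL}(\mathbb{R}^{d+1})$ of projective transformations acts transitively on its realization space $\mathcal{RS}(P)$, where $\mathcal{RS}(P)$ is the set of labelled vertex tuples $V$ such that $\mathrm{conv}(V)$ is combinatorially equivalent to $P$ via an isomorphism of face lattices respecting the vertex labelling. Equivalently: for every polytope $P'$ and every combinatorial isomorphism $\varphi$ from $P$ to $P'$, there is a projective transformation mapping $P$ onto $P'$ and inducing $\varphi$ on the vertices. *)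

theory Defs
  imports "HOL-Analysis.Analysis"
begin

definition vertices :: "'a::euclidean_space set \<Rightarrow> 'a set" where
  "vertices P = {v. v extreme_point_of P}"

definition face_lattice :: "'a::euclidean_space set \<Rightarrow> 'a set set" where
  "face_lattice P = {F. F face_of P}"

definition face_lattice_iso ::
    "('a::euclidean_space set \<Rightarrow> 'b::euclidean_space set) \<Rightarrow> 'a set \<Rightarrow> 'b set \<Rightarrow> bool" where
  "face_lattice_iso \<Phi> P Q \<longleftrightarrow>
     bij_betw \<Phi> (face_lattice P) (face_lattice Q) \<and>
     (\<forall>F\<in>face_lattice P. \<forall>G\<in>face_lattice P. F \<subseteq> G \<longleftrightarrow> \<Phi> F \<subseteq> \<Phi> G)"

definition combinatorially_equivalent ::
    "'a::euclidean_space set \<Rightarrow> 'b::euclidean_space set \<Rightarrow> bool" where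
  "combinatorially_equivalent P Q \<longleftrightarrow> (\<exists>\<Phi>. face_lattice_iso \<Phi> P Q)"

text \<open>
  The vertices of \<open>P\<close> themselves serve as labels: a labelled vertex tuple is a family of points
  indexed by \<open>vertices P\<close>, and a lattice isomorphism respects the labelling if it sends the face
  \<open>{v}\<close> to the face \<open>{V v}\<close>. Members are extensional so that distinct elements of the realization
  space are distinct tuples.
\<close>

definition realization_space :: "'a::euclidean_space set \<Rightarrow> ('a \<Rightarrow> 'a) set" where
  "realization_space P =
     {V \<in> extensional (vertices P).
        \<exists>\<Phi>. face_lattice_iso \<Phi> P (convex hull (V ` vertices P)) \<and>
            (\<forall>v\<in>vertices P. \<Phi> {v} = {V v})}"

text \<open>
  With \<open>'a\<close> of dimension \<open>d\<close>, the space \<open>'a \<times> real\<close> is \<open>d + 1\<close>-dimensional and a point \<open>x\<close> has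
  homogeneous coordinates \<open>(x, 1)\<close>. An element of the projective linear group is represented by a
  linear automorphism \<open>T\<close> of \<open>'a \<times> real\<close>; nonzero multiples of \<open>T\<close> define the same map.
  That map is defined on a set \<open>S\<close> if it sends no point of \<open>S\<close> to the hyperplane at infinity.
\<close>

definition proj_map ::
    "('a::euclidean_space \<times> real \<Rightarrow> 'a \<times> real) \<Rightarrow> 'a \<Rightarrow> 'a" where
  "proj_map T x = fst (T (x, 1)) /\<^sub>R snd (T (x, 1))"

definition proj_transformation_on ::
    "('a::euclidean_space \<times> real \<Rightarrow> 'a \<times> real) \<Rightarrow> 'a set \<Rightarrow> bool" where
  "proj_transformation_on T S \<longleftrightarrow> linear T \<and> bij T \<and> (\<forall>x\<in>S. snd (T (x, 1)) \<noteq> 0)"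

text \<open>
  Transitivity of the action on the realization space. Requiring \<open>T\<close> to be defined on the whole
  polytope, not only on its vertices, makes it map \<open>convex hull (V ` vertices P)\<close> onto
  \<open>convex hull (W ` vertices P)\<close>.
\<close>

definition projectively_unique :: "'a::euclidean_space set \<Rightarrow> bool" where
  "projectively_unique P \<longleftrightarrow>
     (\<forall>V\<in>realization_space P. \<forall>W\<in>realization_space P.
        \<exists>T. proj_transformation_on T (convex hull (V ` vertices P)) \<and>
            (\<forall>v\<in>vertices P. proj_map T (V v) = W v))"

end

theory Submission
  imports Defs
begin

text \<open>
  The polytopes are Lawrence extensions of cyclic \<open>4\<close>-polytopes. Put the points
  \<open>(k, k\<^sup>2, k\<^sup>3, k\<^sup>4)\<close>, \<open>\<bar>k\<bar> \<le> M\<close>, together with a fixed set of \<open>19\<close> directions in \<open>\<real>\<^sup>4\<close>, and double each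
  direction \<open>r\<close> to a pair of vertices \<open>q r\<close>, \<open>q r + r\<close> in a new dimension. A face of the resulting
  polytope is a quartic polynomial that is nonnegative at the integers \<open>-M, \<dots>, M\<close>, together with
  the signs that the directions take on it. The number of directions does not depend on \<open>M\<close>, so
  the dimension stays bounded while the number of vertices grows.

  Among the directions there are, for \<open>s = \<plusminus>2, \<plusminus>3\<close>, two whose annihilator consists of the quartics
  that are symmetric about \<open>s/2\<close>, that is, quadratic polynomials in \<open>k (s - k)\<close>. Hence the quartic
  with roots \<open>a, s - a, a + 1, s - a - 1\<close> defines a face, and this face is determined by one known
  point of each of the two symmetric pairs of roots. Intersecting four such faces, two for each of
  two values of \<open>s\<close>, determines the point \<open>k = m + 1\<close> from the points with \<open>\<bar>k\<bar> \<le> m\<close>; by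
  induction all points are determined by the directions and the points with \<open>\<bar>k\<bar> \<le> 2\<close>. The latter
  are pinned down, starting from a projective frame, by a short chain of incidences.
\<close>


subsection \<open>Polytopes and their realizations\<close>

lemma face_lattice_iso_vertex:
  assumes "face_lattice_iso \<Phi> P Q" "\<Phi> {v} = {w}" "v extreme_point_of P" "F face_of P"
  shows "v \<in> F \<longleftrightarrow> w \<in> \<Phi> F"
proof -
  have "{v} \<in> face_lattice P" "F \<in> face_lattice P"
    using assms by (auto simp: face_lattice_def face_of_singleton)
  then have "{v} \<subseteq> F \<longleftrightarrow> \<Phi> {v} \<subseteq> \<Phi> F" using assms(1) by (auto simp: face_lattice_iso_def)
  then show ?thesis using assms(2) by simp
qed

text \<open>The zeros of a functional nonnegative on \<open>S\<close> cut out a face. Its image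
  under the lattice isomorphism is a face of a polytope, hence exposed, and the supporting
  hyperplane supplies \<open>y\<close>.\<close>

lemma realization_functional:
  fixes S :: "'a::euclidean_space set"
  assumes "finite S" and vts: "vertices (convex hull S) = S" and V: "V \<in> realization_space (convex hull S)"
    and nonneg: "\<And>v. v \<in> S \<Longrightarrow> 0 \<le> n \<bullet> v + m"
  obtains y :: "'a \<times> real" where "\<And>v. v \<in> S \<Longrightarrow> sgn (y \<bullet> (V v, 1)) = sgn (n \<bullet> v + m)"
proof -
  let ?P = "convex hull S" and ?Q = "convex hull (V ` S)"
  obtain \<Phi> where iso: "face_lattice_iso \<Phi> ?P ?Q" and \<Phi>: "\<And>v. v \<in> S \<Longrightarrow> \<Phi> {v} = {V v}"
    using V vts by (auto simp: realization_space_def)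
  define F where "F = ?P \<inter> {x. n \<bullet> x = - m}"
  have "n \<bullet> x \<ge> - m" if "x \<in> ?P" for x
  proof -
    have "?P \<subseteq> {x. n \<bullet> x \<ge> - m}"
      by (rule hull_minimal) (use nonneg in \<open>force simp: convex_halfspace_ge\<close>)+
    then show ?thesis using that by blast
  qed
  then have F: "F face_of ?P" unfolding F_def by (intro face_of_Int_supporting_hyperplane_ge) auto
  then have "\<Phi> F face_of ?Q"
    using iso by (auto simp: face_lattice_iso_def face_lattice_def bij_betw_def)
  moreover have "polyhedron ?Q" using \<open>finite S\<close> by (intro polytope_imp_polyhedron) (auto simp: polytope_def)
  ultimately have "\<Phi> F exposed_face_of ?Q" using exposed_face_of_polyhedron by blast
  then obtain a b where ab: "?Q \<subseteq> {x. a \<bullet> x \<le> b}" "\<Phi> F = ?Q \<inter> {x. a \<bullet> x = b}"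
    unfolding exposed_face_of_def by blast
  show thesis
  \<comment> \<open>The hyperplane bounds \<open>?Q\<close> from above, so the nonnegative
    functional is \<open>b - a \<bullet> x\<close>.\<close>
  proof (rule that[of "(- a, b)"])
    fix v assume v: "v \<in> S"
    have VQ: "V v \<in> ?Q" using v by (simp add: hull_inc)
    have "v extreme_point_of ?P" using v vts by (auto simp: vertices_def)
    then have "v \<in> F \<longleftrightarrow> V v \<in> \<Phi> F" using face_lattice_iso_vertex[OF iso \<Phi>[OF v] _ F] by blast
    moreover have "v \<in> F \<longleftrightarrow> n \<bullet> v + m = 0"
      using v by (auto simp: F_def hull_inc eq_neg_iff_add_eq_0)
    moreover have "V v \<in> \<Phi> F \<longleftrightarrow> a \<bullet> V v = b" using ab(2) VQ by simp
    moreover have "a \<bullet> V v \<le> b" using ab(1) VQ by blast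
    ultimately show "sgn ((- a, b) \<bullet> (V v, 1)) = sgn (n \<bullet> v + m)"
      using nonneg[OF v] by (auto simp: sgn_if)
  qed
qed

text \<open>Two realizations are linear images of the same homogenized vertices, so one map composed
  with the inverse of the other relates them. Positive scalars make the last coordinate positive on
  the vertices, hence on their hull, and no point of the polytope goes to infinity.\<close>

lemma projectively_unique_if_linear_model:
  fixes P :: "'a::euclidean_space set"
  assumes model: "\<And>V. V \<in> realization_space P \<Longrightarrow>
    \<exists>T. linear T \<and> bij T \<and> (\<forall>v\<in>vertices P. \<exists>c>0. T (v, 1::real) = c *\<^sub>R (V v, 1::real))"
  shows "projectively_unique P"
  unfolding projectively_unique_def
proof (intro ballI)
  fix V W assume "V \<in> realization_space P" "W \<in> realization_space P"
  then obtain S T :: "'a \<times> real \<Rightarrow> 'a \<times> real"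
    where S: "linear S" "bij S" "\<forall>v\<in>vertices P. \<exists>c>0. S (v, 1) = c *\<^sub>R (V v, 1)"
      and T: "linear T" "bij T" "\<forall>v\<in>vertices P. \<exists>c>0. T (v, 1) = c *\<^sub>R (W v, 1)"
    using model[of V] model[of W] by blast
  define U where "U = T \<circ> inv S"
  have linU: "linear U" unfolding U_def
    using linear_compose[OF inj_linear_imp_inv_linear[OF S(1) bij_is_inj[OF S(2)]] T(1)] .
  have U: "\<exists>c>0. U (V v, 1) = c *\<^sub>R (W v, 1)" if v: "v \<in> vertices P" for v
  proof -
    obtain c d where c: "c > 0" "S (v, 1) = c *\<^sub>R (V v, 1)" and d: "d > 0" "T (v, 1) = d *\<^sub>R (W v, 1)"
      using S(3) T(3) v by metis
    have "S ((1 / c) *\<^sub>R (v, 1)) = (V v, 1)" using c linear_cmul[OF S(1), of "1 / c" "(v, 1)"] by simp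
    then have "inv S (V v, 1) = (1 / c) *\<^sub>R (v, 1)" using S(2) by (metis bij_inv_eq_iff)
    then have "U (V v, 1) = (1 / c) *\<^sub>R T (v, 1)" by (simp only: U_def o_apply linear_cmul[OF T(1)])
    then show ?thesis using c d by (intro exI[of _ "d / c"]) (simp only: d(2), simp)
  qed
  have pos: "snd (U (x, 1)) > 0" if "x \<in> convex hull (V ` vertices P)" for x
  proof -
    have "convex {x. snd (U (x, 1)) > 0}"
    proof (rule convexI)
      fix x y :: 'a and s t :: real
      assume xy: "x \<in> {x. snd (U (x, 1)) > 0}" "y \<in> {x. snd (U (x, 1)) > 0}" and st: "0 \<le> s" "0 \<le> t" "s + t = 1"
      have "(s *\<^sub>R x + t *\<^sub>R y, 1::real) = s *\<^sub>R (x, 1) + t *\<^sub>R (y, 1)" using st by simp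
      then have "U (s *\<^sub>R x + t *\<^sub>R y, 1) = s *\<^sub>R U (x, 1) + t *\<^sub>R U (y, 1)"
        by (simp only: linear_add[OF linU] linear_cmul[OF linU])
      moreover have "0 < s * snd (U (x, 1)) + t * snd (U (y, 1))"
      proof (cases "s = 0")
        case False then show ?thesis using xy st by (intro add_pos_nonneg) auto
      qed (use xy st in auto)
      ultimately show "s *\<^sub>R x + t *\<^sub>R y \<in> {x. snd (U (x, 1)) > 0}" by simp
    qed
    moreover have "snd (U (V v, 1)) > 0" if "v \<in> vertices P" for v using U[OF that] by auto
    then have "V ` vertices P \<subseteq> {x. snd (U (x, 1)) > 0}" by blast
    ultimately show ?thesis using that hull_minimal[of "V ` vertices P" "{x. snd (U (x, 1)) > 0}" convex] by blast
  qed
  show "\<exists>T. proj_transformation_on T (convex hull (V ` vertices P)) \<and> (\<forall>v\<in>vertices P. proj_map T (V v) = W v)"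
  proof (intro exI[of _ U] conjI ballI)
    have "bij U" unfolding U_def using S T by (intro bij_comp bij_imp_bij_inv)
    then show "proj_transformation_on U (convex hull (V ` vertices P))"
      using linU pos by (simp add: proj_transformation_on_def less_imp_neq[symmetric])
    show "proj_map U (V v) = W v" if "v \<in> vertices P" for v
      using U[OF that] by (auto simp: proj_map_def)
  qed
qed

section \<open>The number of vertices as a combinatorial invariant\<close>

lemma atom_of_polytope_iff:
  assumes "polytope P" "F face_of P"
  shows "(F \<noteq> {} \<and> (\<forall>G. G face_of P \<longrightarrow> G \<subseteq> F \<longrightarrow> G = {} \<or> G = F)) \<longleftrightarrow> (\<exists>v\<in>vertices P. F = {v})"
proof
  assume *: "F \<noteq> {} \<and> (\<forall>G. G face_of P \<longrightarrow> G \<subseteq> F \<longrightarrow> G = {} \<or> G = F)"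
  have "polytope F" using face_of_polytope_polytope assms by blast
  then obtain v where v: "v extreme_point_of F"
    using * extreme_point_exists_convex[of F] polytope_imp_compact polytope_imp_convex by blast
  then have vP: "v extreme_point_of P" using assms(2) extreme_point_of_face by blast
  then have "{v} face_of P" by (simp add: face_of_singleton)
  moreover have "{v} \<subseteq> F" using v by (simp add: extreme_point_of_def)
  ultimately have "F = {v}" using conjunct2[OF *] by (metis insert_not_empty)
  then show "\<exists>v\<in>vertices P. F = {v}" using vP by (auto simp: vertices_def)
qed auto

text \<open>Vertices are the atoms of the face lattice. Atoms are described by inclusion alone, so a
  lattice isomorphism carries them to atoms.\<close>

lemma combinatorially_equivalent_card_vertices:
  assumes "polytope P" "polytope Q" "combinatorially_equivalent P Q"
  shows "card (vertices P) = card (vertices Q)"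
proof -
  obtain \<Phi> where iso: "face_lattice_iso \<Phi> P Q"
    using assms(3) unfolding combinatorially_equivalent_def by blast
  then have bij: "bij_betw \<Phi> (face_lattice P) (face_lattice Q)" by (simp add: face_lattice_iso_def)
  have mono: "F \<subseteq> G \<longleftrightarrow> \<Phi> F \<subseteq> \<Phi> G" if "F \<in> face_lattice P" "G \<in> face_lattice P" for F G
    using iso that by (simp add: face_lattice_iso_def)
  have empty: "{} \<in> face_lattice R" for R :: "'c::euclidean_space set" by (simp add: face_lattice_def)
  have im: "face_lattice Q = \<Phi> ` face_lattice P" using bij by (simp add: bij_betw_def)
  have inj: "\<Phi> G = \<Phi> H \<longleftrightarrow> G = H" if "G \<in> face_lattice P" "H \<in> face_lattice P" for G H
    using bij that by (auto simp: bij_betw_def inj_on_def)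
  have \<Phi>0: "\<Phi> {} = {}"
  proof -
    obtain F where F: "F \<in> face_lattice P" "\<Phi> F = {}" using empty[of Q] unfolding im by force
    then show ?thesis using mono[OF empty[of P] F(1)] by simp
  qed
  define A where "A = (\<lambda>v. {v}) ` vertices P"
  define B where "B = (\<lambda>v. {v}) ` vertices Q"
  have atom: "F \<in> (\<lambda>v. {v}) ` vertices R \<longleftrightarrow>
      F \<in> face_lattice R \<and> F \<noteq> {} \<and> (\<forall>G\<in>face_lattice R. G \<subseteq> F \<longrightarrow> G = {} \<or> G = F)"
    if "polytope R" for R :: "'c::euclidean_space set" and F
  proof -
    have "F \<in> (\<lambda>v. {v}) ` vertices R \<Longrightarrow> F \<in> face_lattice R"
      by (auto simp: face_lattice_def vertices_def face_of_singleton)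
    moreover have "F \<in> (\<lambda>v. {v}) ` vertices R \<longleftrightarrow> (\<exists>v\<in>vertices R. F = {v})" by (simp add: image_iff)
    ultimately show ?thesis
      using atom_of_polytope_iff[OF that, of F] by (simp add: face_lattice_def) argo
  qed
  have "\<Phi> F \<in> B \<longleftrightarrow> F \<in> A" if F: "F \<in> face_lattice P" for F
  proof -
    have "\<Phi> G = {} \<longleftrightarrow> G = {}" if "G \<in> face_lattice P" for G
      using inj[OF that empty] \<Phi>0 by simp
    then show ?thesis
      unfolding A_def B_def atom[OF assms(1)] atom[OF assms(2)] im
      using F inj mono by (simp cong: conj_cong)
  qed
  moreover have "A \<subseteq> face_lattice P" "B \<subseteq> face_lattice Q"
    unfolding A_def B_def using atom[OF assms(1)] atom[OF assms(2)] by blast+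
  ultimately have "\<Phi> ` A = B" unfolding im by blast
  then have "bij_betw \<Phi> A B"
    using bij \<open>A \<subseteq> face_lattice P\<close> unfolding bij_betw_def by (blast intro: inj_on_subset)
  moreover have "card A = card (vertices P)" "card B = card (vertices Q)"
    unfolding A_def B_def by (simp_all add: card_image)
  ultimately show ?thesis using bij_betw_same_card by metis
qed

subsection \<open>Lawrence extensions\<close>

lemma vertices_convex_hull:
  fixes S :: "'a::euclidean_space set"
  assumes "finite S" and exposed: "\<And>v. v \<in> S \<Longrightarrow> \<exists>n m. n \<bullet> v + m = 0 \<and> (\<forall>x\<in>S - {v}. 0 < n \<bullet> x + m)"
  shows "vertices (convex hull S) = S"
proof
  show "vertices (convex hull S) \<subseteq> S"
    unfolding vertices_def using extreme_point_of_convex_hull by blast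
  show "S \<subseteq> vertices (convex hull S)"
  proof
    fix v assume v: "v \<in> S"
    then obtain n m where nm: "n \<bullet> v + m = 0" "\<forall>x\<in>S - {v}. 0 < n \<bullet> x + m" using exposed by blast
    have "convex hull (S - {v}) \<subseteq> {x. n \<bullet> x > - m}"
      by (rule hull_minimal) (use nm(2) in \<open>force simp: convex_halfspace_gt\<close>)+
    then have "v \<notin> convex hull (S - {v})" using nm(1) by force
    then have "v extreme_point_of convex hull (insert v (S - {v}))"
      using \<open>finite S\<close> by (intro extreme_point_of_convex_hull_insert) auto
    then show "v \<in> vertices (convex hull S)" using v by (simp add: vertices_def insert_absorb)
  qed
qed

lemma linear_pair_expansion:
  fixes L :: "real \<times> 'c::euclidean_space \<Rightarrow> 'b::real_vector"
  assumes "linear L"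
  shows "L (s, c) = s *\<^sub>R L (1, 0) + (\<Sum>i\<in>Basis. (c \<bullet> i) *\<^sub>R L (0, i))"
proof -
  have "(s, c) = s *\<^sub>R (1, 0) + (\<Sum>i\<in>Basis. (c \<bullet> i) *\<^sub>R (0, i))"
    by (rule prod_eqI) (simp_all add: fst_sum snd_sum euclidean_representation)
  then have "L (s, c) = L (s *\<^sub>R (1, 0) + (\<Sum>i\<in>Basis. (c \<bullet> i) *\<^sub>R (0, i)))" by simp
  also have "\<dots> = s *\<^sub>R L (1, 0) + (\<Sum>i\<in>Basis. (c \<bullet> i) *\<^sub>R L (0, i))"
    by (simp only: linear_add[OF assms] linear_cmul[OF assms] linear_sum[OF assms])
  finally show ?thesis .
qed

text \<open>\<open>A\<close> is a point configuration and \<open>R\<close> a set of directions in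
  the small space. \<open>b\<close> places that space in \<open>'a\<close>, and \<open>q\<close>
  gives every direction a new coordinate of its own.\<close>

locale lawrence_extension =
  fixes A R :: "'c::euclidean_space set" and b q :: "'c \<Rightarrow> 'a::euclidean_space"
  assumes finite: "finite A" "finite R"
    and b: "inj_on b Basis" "b ` Basis \<subseteq> Basis"
    and q: "inj_on q R" "q ` R \<subseteq> Basis - b ` Basis"
    and zero: "0 \<in> A" "0 \<notin> R"
    and Basis_R: "Basis \<subseteq> R"
    and position: "\<And>a. a \<in> A \<Longrightarrow> \<exists>m n. m + n \<bullet> a = 0 \<and> (\<forall>x\<in>A - {a}. 0 < m + n \<bullet> x)"
begin

section \<open>The extended configuration and its affine functionals\<close>

definition emb :: "'c \<Rightarrow> 'a" where
  "emb c = (\<Sum>i\<in>Basis. (c \<bullet> i) *\<^sub>R b i)"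

definition U :: "'a set" where
  "U = Basis - b ` Basis"

definition S :: "'a set" where
  "S = emb ` A \<union> U \<union> (\<lambda>r. q r + emb r) ` R"

lemma finite_U: "finite U" and finite_S: "finite S"
  by (simp_all add: U_def S_def finite)

lemma Basis_split: "Basis = U \<union> b ` Basis"
  using b by (auto simp: U_def)

lemma q_U: "r \<in> R \<Longrightarrow> q r \<in> U"
  using q by (auto simp: U_def)

lemma linear_emb: "linear emb"
  by (rule linearI) (simp_all add: emb_def inner_add_left scaleR_add_left sum.distrib scaleR_sum_right)

lemma emb_0 [simp]: "emb 0 = 0"
  by (simp add: emb_def)

lemma emb_b: "i \<in> Basis \<Longrightarrow> emb f \<bullet> b i = f \<bullet> i"
proof -
  assume i: "i \<in> Basis"
  have orth: "b j \<bullet> b i = (if j = i then 1 else 0)" if "j \<in> Basis" for j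
  proof -
    have "b j \<in> Basis" "b i \<in> Basis" using b(2) i that by auto
    then show ?thesis using b(1) i that by (auto simp: inner_Basis inj_on_def)
  qed
  have "emb f \<bullet> b i = (\<Sum>j\<in>Basis. if j = i then f \<bullet> j else 0)"
    unfolding emb_def inner_sum_left by (rule sum.cong) (simp_all add: orth)
  then show ?thesis using i by simp
qed

lemma emb_Basis: "i \<in> Basis \<Longrightarrow> emb i = b i"
proof -
  assume i: "i \<in> Basis"
  then have "emb i = (\<Sum>j\<in>Basis. if j = i then b j else 0)"
    unfolding emb_def by (intro sum.cong) (auto simp: inner_Basis)
  then show ?thesis using i by simp
qed

lemma emb_emb: "emb f \<bullet> emb a = f \<bullet> a"
proof -
  have "emb f \<bullet> emb a = (\<Sum>i\<in>Basis. (a \<bullet> i) * (emb f \<bullet> b i))"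
    unfolding emb_def[of a] by (simp add: inner_sum_right)
  then show ?thesis by (simp add: emb_b euclidean_inner[of f a] mult.commute)
qed

lemma inner_U: "u \<in> U \<Longrightarrow> v \<in> U \<Longrightarrow> u \<bullet> v = (if u = v then 1 else 0)"
  by (simp add: U_def inner_Basis)

lemma emb_U: "u \<in> U \<Longrightarrow> emb f \<bullet> u = 0"
proof -
  assume u: "u \<in> U"
  have "b i \<bullet> u = 0" if "i \<in> Basis" for i
    using u that b by (intro inner_not_same_Basis) (auto simp: U_def)
  then show ?thesis by (simp add: emb_def inner_sum_left)
qed

lemma U_b: "u \<in> U \<Longrightarrow> i \<in> Basis \<Longrightarrow> u \<bullet> b i = 0"
  using b by (intro inner_not_same_Basis) (auto simp: U_def)

lemma embI: "(\<And>u. u \<in> U \<Longrightarrow> x \<bullet> u = 0) \<Longrightarrow> x = emb (\<Sum>i\<in>Basis. (x \<bullet> b i) *\<^sub>R i)"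
proof (rule euclidean_eqI)
  fix e :: 'a assume *: "\<And>u. u \<in> U \<Longrightarrow> x \<bullet> u = 0" and "e \<in> Basis"
  then consider "e \<in> U" | i where "i \<in> Basis" "e = b i" using Basis_split by blast
  then show "x \<bullet> e = emb (\<Sum>i\<in>Basis. (x \<bullet> b i) *\<^sub>R i) \<bullet> e"
    by cases (simp_all add: * emb_U emb_b)
qed

text \<open>Belongs to the affine functional with constant term \<open>m\<close> and free values
  \<open>w u\<close> on \<open>U\<close>. On the pair of a direction \<open>r\<close> its values
  differ by \<open>n \<bullet> r\<close>.\<close>

definition normal :: "real \<Rightarrow> 'c \<Rightarrow> ('a \<Rightarrow> real) \<Rightarrow> 'a" where
  "normal m n w = emb n + (\<Sum>u\<in>U. (w u - m) *\<^sub>R u)"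

lemma normal_emb: "normal m n w \<bullet> emb a + m = m + n \<bullet> a"
proof -
  have "normal m n w \<bullet> emb a = n \<bullet> a + (\<Sum>u\<in>U. (w u - m) * (emb a \<bullet> u))"
    by (simp add: normal_def inner_add_left inner_sum_left emb_emb) (simp add: inner_commute)
  then show ?thesis by (simp add: emb_U)
qed

lemma normal_U: "u \<in> U \<Longrightarrow> normal m n w \<bullet> u + m = w u"
  by (simp add: normal_def inner_add_left inner_sum_left emb_U inner_U if_distrib finite_U cong: if_cong)

lemma normal_lift: "r \<in> R \<Longrightarrow> normal m n w \<bullet> (q r + emb r) + m = w (q r) + n \<bullet> r"
  using normal_U[OF q_U, of r m n w] normal_emb[of m n w r] by (simp add: inner_add_right)

text \<open>Values that need not vanish are made positive by a constant exceeding all relevant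
  \<open>\<bar>n \<bullet> x\<bar>\<close>. The two ends of the pair of \<open>r\<close> are
  separated by the normals \<open>r\<close> and \<open>- r\<close>: one end gets 0, the other
  \<open>r \<bullet> r > 0\<close>.\<close>

lemma exposed:
  assumes "v \<in> S"
  shows "\<exists>n m. n \<bullet> v + m = 0 \<and> (\<forall>x\<in>S - {v}. 0 < n \<bullet> x + m)"
proof -
  have big: "\<bar>n \<bullet> x\<bar> < 1 + (\<Sum>x\<in>B. \<bar>n \<bullet> x\<bar>)" if "finite B" "x \<in> B" for n x and B :: "'c set"
    using member_le_sum[of x B "\<lambda>x. \<bar>n \<bullet> x\<bar>"] that by simp
  consider (point) a where "a \<in> A" "v = emb a" | (upper) "v \<in> U" "v \<notin> q ` R"
    | (base) r where "r \<in> R" "v = q r" | (lift) r where "r \<in> R" "v = q r + emb r"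
    using assms by (auto simp: S_def)
  then show ?thesis
  proof cases
    case point
    obtain m n where mn: "m + n \<bullet> a = 0" "\<forall>x\<in>A - {a}. 0 < m + n \<bullet> x" using position[OF point(1)] by blast
    define w :: "'a \<Rightarrow> real" where "w = (\<lambda>u. 1 + (\<Sum>r\<in>R. \<bar>n \<bullet> r\<bar>))"
    have w: "0 < w u" for u by (simp add: w_def add_pos_nonneg sum_nonneg)
    have lift: "0 < w u + n \<bullet> r" if "r \<in> R" for u r using big[OF finite(2) that, of n] by (simp add: w_def)
    show ?thesis
      using mn w lift point
      by (intro exI[of _ "normal m n w"] exI[of _ m]) (auto simp: S_def normal_emb normal_U normal_lift)
  next
    case upper
    define w :: "'a \<Rightarrow> real" where "w = (\<lambda>u. if u = v then 0 else 1)"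
    have "w (q r) = 1" if "r \<in> R" for r using upper(2) that by (auto simp: w_def)
    moreover have "w v = 0" "\<And>u. u \<noteq> v \<Longrightarrow> 0 < w u" by (simp_all add: w_def)
    ultimately show ?thesis
      using upper
      by (intro exI[of _ "normal 1 0 w"] exI[of _ 1]) (auto simp: S_def normal_emb normal_U normal_lift)
  next
    case (base r)
    define m where "m = 1 + (\<Sum>a\<in>A. \<bar>r \<bullet> a\<bar>)"
    define w :: "'a \<Rightarrow> real" where "w = (\<lambda>u. if u = q r then 0 else 1 + (\<Sum>x\<in>R. \<bar>r \<bullet> x\<bar>))"
    have "0 < m + r \<bullet> a" if "a \<in> A" for a using big[OF finite(1) that, of r] by (simp add: m_def)
    moreover have "0 < w u \<longleftrightarrow> u \<noteq> q r" for u by (simp add: w_def add_pos_nonneg sum_nonneg)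
    moreover have "0 < w (q x) + r \<bullet> x" if "x \<in> R" for x
    proof (cases "x = r")
      case True then show ?thesis using zero that by (auto simp: w_def)
    next
      case False
      then have "q x \<noteq> q r" using q(1) that base by (auto simp: inj_on_def)
      then show ?thesis using big[OF finite(2) that, of r] by (simp add: w_def)
    qed
    moreover have "w (q r) = 0" by (simp add: w_def)
    ultimately show ?thesis
      using base q_U[of r]
      by (intro exI[of _ "normal m r w"] exI[of _ m]) (auto simp: S_def normal_emb normal_U normal_lift)
  next
    case (lift r)
    define m where "m = 1 + (\<Sum>a\<in>A. \<bar>(- r) \<bullet> a\<bar>)"
    define w :: "'a \<Rightarrow> real" where "w = (\<lambda>u. if u = q r then r \<bullet> r else 1 + (\<Sum>x\<in>R. \<bar>(- r) \<bullet> x\<bar>))"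
    have "0 < m + (- r) \<bullet> a" if "a \<in> A" for a using big[OF finite(1) that, of "- r"] by (simp add: m_def)
    moreover have "0 < w u" for u using zero lift by (auto simp: w_def intro: add_pos_nonneg sum_nonneg)
    moreover have lifts: "0 < w (q x) + (- r) \<bullet> x" if "x \<in> R" "x \<noteq> r" for x
    proof -
      have "q x \<noteq> q r" using q(1) that lift by (auto simp: inj_on_def)
      then show ?thesis using big[OF finite(2) that(1), of "- r"] by (simp add: w_def)
    qed
    moreover have "w (q r) + (- r) \<bullet> r = 0" by (simp add: w_def)
    ultimately show ?thesis
      using lift
      by (intro exI[of _ "normal m (- r) w"] exI[of _ m])
        (auto simp: S_def normal_emb normal_U normal_lift simp del: inner_minus_left, metis lifts)
  qed
qed

lemma vertices_S: "vertices (convex hull S) = S"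
  using finite_S exposed by (rule vertices_convex_hull)

lemma card_S: "card S = card A + card R + (DIM('a) - DIM('c))"
proof -
  have inj: "inj emb" by (rule injI) (metis emb_emb inner_eq_zero_iff linear_diff[OF linear_emb] eq_iff_diff_eq_0)
  have inj2: "inj_on (\<lambda>r. q r + emb r) R"
  proof (rule inj_onI)
    fix r s assume rs: "r \<in> R" "s \<in> R" "q r + emb r = q s + emb s"
    have "(q r + emb r) \<bullet> q r = 1" using q_U[OF rs(1)] by (simp add: inner_add_left inner_U emb_U)
    then have "q s \<bullet> q r = 1" using rs q_U[OF rs(1)] by (simp add: inner_add_left emb_U)
    then have "q r = q s" using inner_U[OF q_U q_U, of s r] rs by (auto split: if_splits)
    then show "r = s" using q(1) rs by (auto simp: inj_on_def)
  qed
  have "emb ` A \<inter> U = {}"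
    using emb_U inner_U by (force simp: disjoint_iff)
  moreover have "q r + emb r \<notin> emb ` A \<union> U" if r: "r \<in> R" for r
  proof
    assume "q r + emb r \<in> emb ` A \<union> U"
    then consider a where "q r + emb r = emb a" | "q r + emb r \<in> U" by blast
    then show False
    proof cases
      case 1
      then have "(q r + emb r) \<bullet> q r = 0" using q_U[OF r] by (simp add: emb_U)
      then show False using q_U[OF r] by (simp add: inner_add_left inner_U emb_U)
    next
      case 2
      have "emb r \<bullet> (q r + emb r) = 0" using emb_U[OF 2] .
      then have "r \<bullet> r = 0" using q_U[OF r] by (simp add: inner_add_right emb_U emb_emb)
      then show False using zero r by simp
    qed
  qed
  ultimately have "card S = card (emb ` A) + card U + card ((\<lambda>r. q r + emb r) ` R)"
    unfolding S_def using finite finite_U by (subst card_Un_disjoint; (subst card_Un_disjoint)?; auto)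
  also have "card U = DIM('a) - DIM('c)"
    unfolding U_def using b by (simp add: card_Diff_subset card_image)
  finally show ?thesis using inj inj2 by (simp add: card_image inj_on_subset)
qed

lemma aff_dim_S: "aff_dim (convex hull S) = DIM('a)"
proof -
  have "0 \<in> S" using zero(1) unfolding S_def by (auto intro!: image_eqI[of _ _ 0])
  have "Basis \<subseteq> span S"
  proof
    fix e :: 'a assume "e \<in> Basis"
    then consider "e \<in> U" | i where "i \<in> Basis" "e = b i" using Basis_split by blast
    then show "e \<in> span S"
    proof cases
      case 1 then show ?thesis by (auto simp: S_def intro: span_base)
    next
      case 2
      then have i: "i \<in> R" using Basis_R by blast
      have "emb i = e" using 2 by (simp add: emb_Basis)
      moreover have "(q i + emb i) - q i \<in> span S"
        using i q_U[OF i] by (intro span_diff span_base) (auto simp: S_def)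
      ultimately show ?thesis by simp
    qed
  qed
  then have "span S = UNIV" using span_Basis span_mono span_span by (metis top.extremum_unique)
  then have "affine hull S = UNIV" using affine_hull_span_0[of S] \<open>0 \<in> S\<close> by (simp add: hull_inc)
  then show ?thesis by (metis aff_dim_UNIV aff_dim_affine_hull aff_dim_convex_hull)
qed

text \<open>The linear map with \<open>(0, 1) \<mapsto> p\<close>,
  \<open>(b i, 0) \<mapsto> \<rho> i\<close> and \<open>(u, 1) \<mapsto> Q u\<close>. The vectors
  \<open>(u, 1)\<close> contribute to the last coordinate, which is why a sum is subtracted in the
  coefficient of \<open>p\<close>.\<close>

definition frame_map :: "'a \<times> real \<Rightarrow> ('c \<Rightarrow> 'a \<times> real) \<Rightarrow> ('a \<Rightarrow> 'a \<times> real) \<Rightarrow> 'a \<times> real \<Rightarrow> 'a \<times> real" where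
  "frame_map p \<rho> Q z = (snd z - (\<Sum>u\<in>U. fst z \<bullet> u)) *\<^sub>R p + (\<Sum>i\<in>Basis. (fst z \<bullet> b i) *\<^sub>R \<rho> i)
     + (\<Sum>u\<in>U. (fst z \<bullet> u) *\<^sub>R Q u)"

lemma linear_frame_map: "linear (frame_map p \<rho> Q)"
  by (rule linearI)
    (simp_all add: frame_map_def inner_add_left scaleR_add_left scaleR_diff_left sum.distrib scaleR_sum_right
      sum_distrib_left[symmetric] algebra_simps)

lemma frame_map_emb: "frame_map p \<rho> Q (emb c, s) = s *\<^sub>R p + (\<Sum>i\<in>Basis. (c \<bullet> i) *\<^sub>R \<rho> i)"
  by (simp add: frame_map_def emb_U emb_b)

lemma frame_map_U:
  assumes "u \<in> U"
  shows "frame_map p \<rho> Q (u, 1) = Q u"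
proof -
  have "(\<Sum>v\<in>U. (u \<bullet> v) *\<^sub>R Q v) = (\<Sum>v\<in>U. if v = u then Q v else 0)"
    using assms by (intro sum.cong) (auto simp: inner_U)
  moreover have "(\<Sum>v\<in>U. u \<bullet> v) = (\<Sum>v\<in>U. if v = u then 1 else 0)"
    using assms by (intro sum.cong) (auto simp: inner_U)
  ultimately show ?thesis using assms by (simp add: frame_map_def U_b finite_U)
qed

lemma frame_map_lift:
  assumes "r \<in> R"
  shows "frame_map p \<rho> Q (q r + emb r, 1) = Q (q r) + (\<Sum>i\<in>Basis. (r \<bullet> i) *\<^sub>R \<rho> i)"
proof -
  have "frame_map p \<rho> Q ((q r, 1) + (emb r, 0)) = frame_map p \<rho> Q (q r, 1) + frame_map p \<rho> Q (emb r, 0)"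
    by (rule linear_add[OF linear_frame_map])
  then show ?thesis using frame_map_U[OF q_U[OF assms]] by (simp add: frame_map_emb)
qed

text \<open>The system is block triangular: the functionals for \<open>U\<close> kill the rest of
  the frame, the one for \<open>p\<close> kills the \<open>\<rho> i\<close>, and each of the last
  kind kills the other \<open>\<rho> j\<close>. A kernel vector loses its coordinates in this
  order.\<close>

lemma bij_frame_map:
  assumes Y: "\<And>u. u \<in> U \<Longrightarrow> \<exists>y. y \<bullet> Q u \<noteq> 0 \<and> (\<forall>v\<in>U - {u}. y \<bullet> Q v = 0) \<and> y \<bullet> p = 0 \<and> (\<forall>i\<in>Basis. y \<bullet> \<rho> i = 0)"
    and p: "\<exists>y. y \<bullet> p \<noteq> 0 \<and> (\<forall>i\<in>Basis. y \<bullet> \<rho> i = 0)"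
    and \<rho>: "\<And>i. i \<in> Basis \<Longrightarrow> \<exists>y. y \<bullet> \<rho> i \<noteq> 0 \<and> (\<forall>j\<in>Basis - {i}. y \<bullet> \<rho> j = 0)"
  shows "bij (frame_map p \<rho> Q)"
proof -
  have single: "(\<Sum>v\<in>B. c v * (y \<bullet> F v)) = c u * (y \<bullet> F u)"
    if "finite B" "u \<in> B" "\<forall>v\<in>B - {u}. y \<bullet> F v = 0" for B :: "'e set" and c F u and y :: "'a \<times> real"
    using that by (subst sum.remove[of B u]) auto
  have "z = 0" if z: "frame_map p \<rho> Q z = 0" for z
  proof -
    have inner: "0 = (snd z - (\<Sum>u\<in>U. fst z \<bullet> u)) * (y \<bullet> p) + (\<Sum>i\<in>Basis. (fst z \<bullet> b i) * (y \<bullet> \<rho> i))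
      + (\<Sum>u\<in>U. (fst z \<bullet> u) * (y \<bullet> Q u))" for y
      using arg_cong[OF z, of "\<lambda>x. y \<bullet> x"] by (simp add: frame_map_def inner_add_right inner_sum_right)
    have U: "fst z \<bullet> u = 0" if "u \<in> U" for u
    proof -
      obtain y where y: "y \<bullet> Q u \<noteq> 0" "\<forall>v\<in>U - {u}. y \<bullet> Q v = 0" "y \<bullet> p = 0" "\<forall>i\<in>Basis. y \<bullet> \<rho> i = 0"
        using Y[OF \<open>u \<in> U\<close>] by blast
      then show ?thesis
        using inner[of y] single[OF finite_U that y(2), of "\<lambda>u. fst z \<bullet> u"] by simp
    qed
    have s: "snd z = 0"
    proof -
      obtain y where y: "y \<bullet> p \<noteq> 0" "\<forall>i\<in>Basis. y \<bullet> \<rho> i = 0" using p by blast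
      then show ?thesis using inner[of y] U by simp
    qed
    have b: "fst z \<bullet> b i = 0" if "i \<in> Basis" for i
    proof -
      obtain y where y: "y \<bullet> \<rho> i \<noteq> 0" "\<forall>j\<in>Basis - {i}. y \<bullet> \<rho> j = 0" using \<rho>[OF \<open>i \<in> Basis\<close>] by blast
      then show ?thesis
        using inner[of y] U s single[OF finite_Basis that y(2), of "\<lambda>i. fst z \<bullet> b i"] by simp
    qed
    have "fst z = 0"
    proof (rule euclidean_eqI)
      fix e :: 'a assume "e \<in> Basis"
      then consider "e \<in> U" | i where "i \<in> Basis" "e = b i" using Basis_split by blast
      then show "fst z \<bullet> e = 0 \<bullet> e" by cases (simp_all add: U b)
    qed
    then show ?thesis using s by (simp add: prod_eq_iff)
  qed
  then have "inj (frame_map p \<rho> Q)"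
    using linear_injective_0[OF linear_frame_map] by blast
  then show ?thesis
    using linear_injective_imp_surjective[OF linear_frame_map] by (simp add: bij_def)
qed

text \<open>\<open>X\<close> stands for a realization read in the small space, normalized on a frame
  and keeping the signs of all functionals nonnegative on \<open>A\<close>. Such an \<open>X\<close>
  is recovered from \<open>V\<close>; rigidity makes it diagonal up to positive scalars, and the
  diagonal map extends to the new coordinates.\<close>

lemma projectively_unique_hull:
  assumes rigid: "\<And>X :: real \<times> 'c \<Rightarrow> real \<times> 'c.
      (\<And>f. (\<forall>a\<in>A. 0 \<le> f \<bullet> (1, a)) \<Longrightarrow> \<exists>g. \<forall>x\<in>{1} \<times> A \<union> {0} \<times> R. sgn (g \<bullet> X x) = sgn (f \<bullet> x)) \<Longrightarrow>
      X (1, 0) = (1, 0) \<Longrightarrow> (\<And>i. i \<in> Basis \<Longrightarrow> X (0, i) = (0, i)) \<Longrightarrow>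
      \<exists>D. linear D \<and> (\<exists>a>0. D (1, 0) = a *\<^sub>R (1, 0)) \<and> (\<forall>i\<in>Basis. \<exists>a>0. D (0, i) = a *\<^sub>R (0, i)) \<and>
        (\<forall>x\<in>{1} \<times> A \<union> {0} \<times> R. \<exists>c>0. X x = c *\<^sub>R D x)"
  shows "projectively_unique (convex hull S)"
proof (rule projectively_unique_if_linear_model)
  fix V assume V: "V \<in> realization_space (convex hull S)"
  define h where "h v = (V v, 1::real)" for v
  have functional: "\<exists>y. (\<forall>a\<in>A. sgn (y \<bullet> h (emb a)) = sgn (m + n \<bullet> a)) \<and> (\<forall>u\<in>U. sgn (y \<bullet> h u) = sgn (w u)) \<and>
      (\<forall>r\<in>R. sgn (y \<bullet> h (q r + emb r)) = sgn (w (q r) + n \<bullet> r))"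
    if "\<forall>a\<in>A. 0 \<le> m + n \<bullet> a" "\<forall>u\<in>U. 0 \<le> w u" "\<forall>r\<in>R. 0 \<le> w (q r) + n \<bullet> r" for m n w
  proof -
    have "0 \<le> normal m n w \<bullet> v + m" if "v \<in> S" for v
      using that \<open>\<forall>a\<in>A. 0 \<le> m + n \<bullet> a\<close> \<open>\<forall>u\<in>U. 0 \<le> w u\<close> \<open>\<forall>r\<in>R. 0 \<le> w (q r) + n \<bullet> r\<close>
      by (auto simp: S_def normal_emb normal_U normal_lift)
    then obtain y where y: "\<And>v. v \<in> S \<Longrightarrow> sgn (y \<bullet> h v) = sgn (normal m n w \<bullet> v + m)"
      unfolding h_def using realization_functional[OF finite_S vertices_S V] by blast
    have "sgn (y \<bullet> h (emb a)) = sgn (m + n \<bullet> a)" if "a \<in> A" for a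
      using y[of "emb a"] that by (simp add: S_def normal_emb)
    moreover have "sgn (y \<bullet> h u) = sgn (w u)" if "u \<in> U" for u
      using y[of u] that by (simp add: S_def normal_U)
    moreover have "sgn (y \<bullet> h (q r + emb r)) = sgn (w (q r) + n \<bullet> r)" if "r \<in> R" for r
      using y[of "q r + emb r"] that by (simp add: S_def normal_lift)
    ultimately show ?thesis by blast
  qed
  \<comment> \<open>\<open>Y u\<close> will play the role of the coordinate \<open>u\<close> in the
    realization: it belongs to the face of all vertices whose coordinate \<open>u\<close> is
    0.\<close>
  define dual where "dual u y \<longleftrightarrow> (\<forall>a\<in>A. sgn (y \<bullet> h (emb a)) = 0) \<and>
      (\<forall>v\<in>U. sgn (y \<bullet> h v) = (if v = u then 1 else 0)) \<and>
      (\<forall>r\<in>R. sgn (y \<bullet> h (q r + emb r)) = (if q r = u then 1 else 0))" for u y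
  have "\<exists>y. dual u y" for u
    unfolding dual_def
    using functional[of 0 0 "\<lambda>v. if v = u then 1 else 0"] by (simp add: if_distrib[of sgn] cong: if_cong)
  then have "\<exists>Y. \<forall>u. dual u (Y u)" by (intro choice allI)
  then obtain Y where Y0: "\<And>u. dual u (Y u)" by blast
  have Y1: "Y u \<bullet> h (emb a) = 0" if "a \<in> A" for u a using Y0[of u] that by (simp add: sgn_zero_iff dual_def)
  have Y2: "sgn (Y u \<bullet> h v) = (if v = u then 1 else 0)" if "v \<in> U" for u v
    using Y0[of u] that by (simp add: dual_def)
  have Y3: "sgn (Y u \<bullet> h (q r + emb r)) = (if q r = u then 1 else 0)" if "r \<in> R" for u r
    using Y0[of u] that by (simp add: dual_def)
  have Y2_pos: "0 < Y u \<bullet> h u" if "u \<in> U" for u using Y2[OF that, of u] by (simp add: sgn_1_pos)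
  have Y3_pos: "0 < Y (q r) \<bullet> h (q r + emb r)" if "r \<in> R" for r using Y3[OF that, of "q r"] by (simp add: sgn_1_pos)
  define Q where "Q u = h u /\<^sub>R (Y u \<bullet> h u)" for u
  define t where "t r = h (q r + emb r) /\<^sub>R (Y (q r) \<bullet> h (q r + emb r))" for r
  \<comment> \<open>With both ends of the pair scaled to value 1 under \<open>Y (q r)\<close>, their
    difference is killed by all \<open>Y u\<close>; it is the direction \<open>r\<close> as seen in
    the realization.\<close>
  define \<rho> where "\<rho> r = t r - Q (q r)" for r
  have YQ: "Y u \<bullet> Q v = (if v = u then 1 else 0)" if "u \<in> U" "v \<in> U" for u v
    using Y2_pos[OF that(2)] Y2[OF that(2), of u] by (auto simp: Q_def sgn_zero_iff split: if_splits)
  have Y\<rho>: "Y u \<bullet> \<rho> r = 0" if "u \<in> U" "r \<in> R" for u r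
    using Y3_pos[OF that(2)] Y3[OF that(2), of u] YQ[OF that(1) q_U[OF that(2)]]
    by (auto simp: \<rho>_def t_def inner_diff_right sgn_zero_iff split: if_splits)
  have dirs: "\<exists>y. (\<forall>a\<in>A. sgn (y \<bullet> h (emb a)) = sgn (m + n \<bullet> a)) \<and> (\<forall>r\<in>R. sgn (y \<bullet> \<rho> r) = sgn (n \<bullet> r))"
    if mn: "\<forall>a\<in>A. 0 \<le> m + n \<bullet> a" for m n
  proof -
    \<comment> \<open>The least value keeping both ends of a pair nonnegative. At least one end then
      lies on the face, and which one it is tells the sign of \<open>n \<bullet> r\<close>; this is
      how a pair of vertices encodes a direction.\<close>
    define w where "w u = (if u \<in> q ` R then max 0 (- (n \<bullet> inv_into R q u)) else 0)" for u
    have w: "w (q r) = max 0 (- (n \<bullet> r))" if "r \<in> R" for r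
      using that q(1) by (simp add: w_def)
    have "\<forall>r\<in>R. 0 \<le> w (q r) + n \<bullet> r" by (simp add: w max_def)
    moreover have "\<forall>u\<in>U. 0 \<le> w u" by (simp add: w_def)
    ultimately obtain y where y: "\<forall>a\<in>A. sgn (y \<bullet> h (emb a)) = sgn (m + n \<bullet> a)"
        "\<forall>u\<in>U. sgn (y \<bullet> h u) = sgn (w u)" "\<forall>r\<in>R. sgn (y \<bullet> h (q r + emb r)) = sgn (w (q r) + n \<bullet> r)"
      using functional[OF mn] by blast
    have "sgn (y \<bullet> \<rho> r) = sgn (n \<bullet> r)" if r: "r \<in> R" for r
    proof -
      have yQ: "sgn (y \<bullet> Q (q r)) = sgn (w (q r))"
        using y(2) q_U[OF r] Y2_pos[OF q_U[OF r]] by (simp add: Q_def sgn_mult)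
      have yt: "sgn (y \<bullet> t r) = sgn (w (q r) + n \<bullet> r)"
        using y(3) r Y3_pos[OF r] by (simp add: t_def sgn_mult)
      consider "n \<bullet> r > 0" | "n \<bullet> r = 0" | "n \<bullet> r < 0" by linarith
      then show ?thesis
      proof cases
        case 1
        then have "y \<bullet> Q (q r) = 0" "y \<bullet> t r > 0"
          using yQ yt w[OF r] by (simp_all add: sgn_zero_iff sgn_1_pos)
        then show ?thesis using 1 by (simp add: \<rho>_def inner_diff_right)
      next
        case 2
        then have "y \<bullet> Q (q r) = 0" "y \<bullet> t r = 0"
          using yQ yt w[OF r] by (simp_all add: sgn_zero_iff)
        then show ?thesis using 2 by (simp add: \<rho>_def inner_diff_right)
      next
        case 3
        then have "y \<bullet> Q (q r) > 0" "y \<bullet> t r = 0"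
          using yQ yt w[OF r] by (simp_all add: sgn_zero_iff sgn_1_pos)
        then show ?thesis using 3 by (simp add: \<rho>_def inner_diff_right)
      qed
    qed
    with y(1) show ?thesis by blast
  qed
  define p where "p = h (emb 0)"
  have Yp: "Y u \<bullet> p = 0" if "u \<in> U" for u using Y1[OF zero(1)] by (simp only: p_def)
  \<comment> \<open>Arbitrary scalars are allowed because both the plain frame of \<open>F\<close>
    and the rescaled frame of \<open>T\<close> are needed.\<close>
  have frame_Y: "\<exists>y. y \<bullet> (\<kappa> u *\<^sub>R Q u) \<noteq> 0 \<and> (\<forall>v\<in>U - {u}. y \<bullet> (\<kappa> v *\<^sub>R Q v) = 0) \<and>
      y \<bullet> (\<beta> *\<^sub>R p) = 0 \<and> (\<forall>i\<in>Basis. y \<bullet> (\<alpha> i *\<^sub>R \<rho> i) = 0)"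
    if "u \<in> U" "\<kappa> u \<noteq> 0" for u \<kappa> \<beta> \<alpha>
  proof (intro exI[of _ "Y u"] conjI ballI)
    show "Y u \<bullet> (\<kappa> u *\<^sub>R Q u) \<noteq> 0" using that YQ[of u u] by simp
    show "Y u \<bullet> (\<kappa> v *\<^sub>R Q v) = 0" if "v \<in> U - {u}" for v using that \<open>u \<in> U\<close> YQ[of u v] by simp
    show "Y u \<bullet> (\<beta> *\<^sub>R p) = 0" using that Yp[of u] by simp
    show "Y u \<bullet> (\<alpha> i *\<^sub>R \<rho> i) = 0" if "i \<in> Basis" for i using that \<open>u \<in> U\<close> Y\<rho>[of u i] Basis_R by auto
  qed
  have frame_p: "\<exists>y. y \<bullet> (\<beta> *\<^sub>R p) \<noteq> 0 \<and> (\<forall>i\<in>Basis. y \<bullet> (\<alpha> i *\<^sub>R \<rho> i) = 0)" if "\<beta> \<noteq> 0" for \<beta> \<alpha>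
  proof -
    obtain y where "\<forall>a\<in>A. sgn (y \<bullet> h (emb a)) = 1" "\<forall>r\<in>R. sgn (y \<bullet> \<rho> r) = 0"
      using dirs[of 1 0] by auto
    then show ?thesis
      using that zero(1) Basis_R unfolding p_def by (intro exI[of _ y]) (auto simp: sgn_zero_iff sgn_1_pos)
  qed
  have frame_\<rho>: "\<exists>y. y \<bullet> (\<alpha> i *\<^sub>R \<rho> i) \<noteq> 0 \<and> (\<forall>j\<in>Basis - {i}. y \<bullet> (\<alpha> j *\<^sub>R \<rho> j) = 0)"
    if "i \<in> Basis" "\<alpha> i \<noteq> 0" for i \<alpha>
  proof -
    have "\<bar>i \<bullet> a\<bar> \<le> (\<Sum>a\<in>A. \<bar>i \<bullet> a\<bar>)" if "a \<in> A" for a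
      using that finite(1) by (intro member_le_sum) auto
    then have "\<forall>a\<in>A. 0 \<le> (\<Sum>a\<in>A. \<bar>i \<bullet> a\<bar>) + i \<bullet> a" by (smt (verit))
    then obtain y where "\<forall>r\<in>R. sgn (y \<bullet> \<rho> r) = sgn (i \<bullet> r)" using dirs by blast
    then have "\<forall>j\<in>Basis. sgn (y \<bullet> \<rho> j) = (if j = i then 1 else 0)"
      using that(1) Basis_R by (auto simp: inner_Basis subset_iff)
    then show ?thesis using that by (intro exI[of _ y]) (auto simp: sgn_zero_iff sgn_1_pos)
  qed
  have bij: "bij (frame_map (\<beta> *\<^sub>R p) (\<lambda>i. \<alpha> i *\<^sub>R \<rho> i) (\<lambda>u. \<kappa> u *\<^sub>R Q u))"
    if "\<beta> \<noteq> 0" "\<And>i. i \<in> Basis \<Longrightarrow> \<alpha> i \<noteq> 0" "\<And>u. u \<in> U \<Longrightarrow> \<kappa> u \<noteq> 0" for \<alpha> \<beta> \<kappa>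
    by (rule bij_frame_map; (rule frame_Y frame_p frame_\<rho>); (rule that | assumption)+)
  define F where "F = frame_map p \<rho> Q"
  have bijF: "bij F" using bij[of 1 "\<lambda>_. 1" "\<lambda>_. 1"] by (simp add: F_def)
  \<comment> \<open>\<open>J\<close> identifies the small space with the common kernel of the
    \<open>Y u\<close>, where the realized points and directions live.\<close>
  define J where "J x = F (emb (snd x), fst x)" for x
  have J: "J (s, c) = s *\<^sub>R p + (\<Sum>i\<in>Basis. (c \<bullet> i) *\<^sub>R \<rho> i)" for s c
    by (simp add: J_def F_def frame_map_emb)
  have J0: "J (0, i) = \<rho> i" if "i \<in> Basis" for i
  proof -
    have "(\<Sum>j\<in>Basis. (i \<bullet> j) *\<^sub>R \<rho> j) = (\<Sum>j\<in>Basis. if j = i then \<rho> j else 0)"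
      using that by (intro sum.cong refl) (simp add: inner_Basis)
    then show ?thesis using that unfolding J by simp
  qed
  have linJ: "linear J"
    by (rule linearI) (auto simp: J_def F_def linear_add[OF linear_emb] linear_cmul[OF linear_emb]
        linear_add[OF linear_frame_map, symmetric] linear_cmul[OF linear_frame_map, symmetric])
  have injJ: "inj J"
  proof (rule injI)
    fix x y assume "J x = J y"
    then have "emb (snd x) = emb (snd y)" "fst x = fst y"
      using bij_is_inj[OF bijF] by (auto simp: J_def inj_def)
    moreover have "emb (snd x - snd y) \<bullet> emb (snd x - snd y) = 0"
      using calculation(1) by (simp add: linear_diff[OF linear_emb])
    ultimately show "x = y" by (simp add: emb_emb prod_eq_iff)
  qed
  have range_J: "z \<in> range J" if z: "\<And>u. u \<in> U \<Longrightarrow> Y u \<bullet> z = 0" for z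
  proof -
    obtain x s where xs: "z = F (x, s)" using bijF by (metis bij_pointE surj_pair)
    have "x \<bullet> u = 0" if u: "u \<in> U" for u
    proof -
      have "Y u \<bullet> z = (\<Sum>v\<in>U. (x \<bullet> v) * (Y u \<bullet> Q v))"
        using Yp[OF u] Y\<rho>[OF u] Basis_R
        by (auto simp: xs F_def frame_map_def inner_add_right inner_sum_right subset_iff)
      also have "\<dots> = (\<Sum>v\<in>U. if v = u then x \<bullet> v else 0)"
        using YQ[OF u] by (intro sum.cong) auto
      finally show ?thesis using z[OF u] u finite_U by simp
    qed
    from embI[OF this] show ?thesis unfolding xs J_def image_iff by (metis fst_conv snd_conv UNIV_I)
  qed
  define target where "target x = (if fst x = 1 then h (emb (snd x)) else \<rho> (snd x))" for x :: "real \<times> 'c"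
  define X where "X x = inv J (target x)" for x
  have JX: "J (X x) = target x" if "x \<in> {1} \<times> A \<union> {0} \<times> R" for x
    unfolding X_def using that Y1 Y\<rho> by (intro f_inv_into_f range_J) (auto simp: target_def)
  have "\<exists>D. linear D \<and> (\<exists>a>0. D (1, 0) = a *\<^sub>R (1, 0)) \<and> (\<forall>i\<in>Basis. \<exists>a>0. D (0, i) = a *\<^sub>R (0, i)) \<and>
        (\<forall>x\<in>{1} \<times> A \<union> {0} \<times> R. \<exists>c>0. X x = c *\<^sub>R D x)"
  proof (rule rigid)
    fix f :: "real \<times> 'c" assume f: "\<forall>a\<in>A. 0 \<le> f \<bullet> (1, a)"
    then have "\<forall>a\<in>A. 0 \<le> fst f + snd f \<bullet> a" by (simp add: inner_prod_def)
    then obtain y where y: "\<forall>a\<in>A. sgn (y \<bullet> h (emb a)) = sgn (fst f + snd f \<bullet> a)" "\<forall>r\<in>R. sgn (y \<bullet> \<rho> r) = sgn (snd f \<bullet> r)"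
      using dirs by blast
    \<comment> \<open>\<open>y\<close> pulled back along \<open>J\<close>.\<close>
    define g where "g = (y \<bullet> p, \<Sum>i\<in>Basis. (y \<bullet> \<rho> i) *\<^sub>R i)"
    have "g \<bullet> x = y \<bullet> J x" for x
      by (cases x) (simp add: g_def J inner_add_right inner_sum_right inner_sum_left mult.commute inner_commute)
    then have "g \<bullet> X x = y \<bullet> target x" if "x \<in> {1} \<times> A \<union> {0} \<times> R" for x using JX[OF that] by simp
    then have "\<forall>x\<in>{1} \<times> A \<union> {0} \<times> R. sgn (g \<bullet> X x) = sgn (f \<bullet> x)"
      using y by (auto simp: target_def inner_prod_def)
    then show "\<exists>g. \<forall>x\<in>{1} \<times> A \<union> {0} \<times> R. sgn (g \<bullet> X x) = sgn (f \<bullet> x)" by blast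
  next
    have "J (1, 0) = target (1, 0)" by (simp add: J target_def p_def)
    then show "X (1, 0) = (1, 0)" unfolding X_def using inv_f_f[OF injJ] by metis
    fix i :: 'c assume "i \<in> Basis"
    then have "J (0, i) = target (0, i)" by (simp add: J0 target_def)
    then show "X (0, i) = (0, i)" unfolding X_def using inv_f_f[OF injJ] by metis
  qed
  then obtain D \<beta> where D: "linear D" "\<beta> > 0" "D (1, 0) = \<beta> *\<^sub>R (1, 0)" "\<forall>i\<in>Basis. \<exists>a>0. D (0, i) = a *\<^sub>R (0, i)"
      and X: "\<forall>x\<in>{1} \<times> A \<union> {0} \<times> R. \<exists>c>0. X x = c *\<^sub>R D x" by blast
  obtain \<alpha> where \<alpha>: "\<forall>i\<in>Basis. \<alpha> i > 0 \<and> D (0, i) = \<alpha> i *\<^sub>R (0, i)" using bchoice[OF D(4)] by blast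
  obtain c where c: "\<forall>x\<in>{1} \<times> A \<union> {0} \<times> R. c x > 0 \<and> X x = c x *\<^sub>R D x" using bchoice[OF X] by blast
  \<comment> \<open>The direction \<open>r\<close> is realized up to the factor
    \<open>1 / c (0, r)\<close>; scaling the base \<open>Q (q r)\<close> by the same factor makes
    the image of the lift a multiple of \<open>t r\<close>.\<close>
  define \<kappa> where "\<kappa> u = (if u \<in> q ` R then 1 / c (0, inv_into R q u) else 1)" for u
  have \<kappa>q: "\<kappa> (q r) = 1 / c (0, r)" if "r \<in> R" for r using that q(1) by (simp add: \<kappa>_def)
  have \<kappa>: "\<kappa> u > 0" for u using c q(1) by (auto simp: \<kappa>_def)
  define T where "T = frame_map (\<beta> *\<^sub>R p) (\<lambda>i. \<alpha> i *\<^sub>R \<rho> i) (\<lambda>u. \<kappa> u *\<^sub>R Q u)"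
  have "bij T" unfolding T_def using D(2) \<alpha> \<kappa> by (intro bij) (auto simp: less_imp_neq[symmetric])
  have JD: "J (D (s, a)) = s *\<^sub>R \<beta> *\<^sub>R p + (\<Sum>i\<in>Basis. (a \<bullet> i) *\<^sub>R \<alpha> i *\<^sub>R \<rho> i)" for s a
  proof -
    have J1: "J (1, 0) = p" by (simp add: J)
    have "J (D (s, a)) = s *\<^sub>R J (D (1, 0)) + (\<Sum>i\<in>Basis. (a \<bullet> i) *\<^sub>R J (D (0, i)))"
      using linear_pair_expansion[OF linear_compose[OF D(1) linJ], of s a] by (simp only: o_apply)
    also have "J (D (1, 0)) = \<beta> *\<^sub>R p" by (simp only: D(3) linear_cmul[OF linJ] J1)
    also have "(\<Sum>i\<in>Basis. (a \<bullet> i) *\<^sub>R J (D (0, i))) = (\<Sum>i\<in>Basis. (a \<bullet> i) *\<^sub>R \<alpha> i *\<^sub>R \<rho> i)"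
      using \<alpha> J0 by (intro sum.cong) (simp_all only: linear_cmul[OF linJ])
    finally show ?thesis .
  qed
  have JDX: "J (D x) = target x /\<^sub>R c x" "c x > 0" if "x \<in> {1} \<times> A \<union> {0} \<times> R" for x
  proof -
    show pos: "c x > 0" using c that by blast
    have "X x = c x *\<^sub>R D x" using c that by blast
    then have "D x = (1 / c x) *\<^sub>R X x" using pos by simp
    then show "J (D x) = target x /\<^sub>R c x"
      using JX[OF that] by (simp only: linear_cmul[OF linJ] inverse_eq_divide)
  qed
  show "\<exists>T. linear T \<and> bij T \<and> (\<forall>v\<in>vertices (convex hull S). \<exists>c>0. T (v, 1::real) = c *\<^sub>R (V v, 1::real))"
  proof (intro exI[of _ T] conjI ballI)
    show "linear T" unfolding T_def by (rule linear_frame_map)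
    fix v assume "v \<in> vertices (convex hull S)"
    then consider a where "a \<in> A" "v = emb a" | "v \<in> U" | r where "r \<in> R" "v = q r + emb r"
      unfolding vertices_S by (auto simp: S_def)
    then have "\<exists>c>0. T (v, 1) = c *\<^sub>R h v"
    proof cases
      case 1
      have "T (v, 1) = J (D (1, a))" by (simp add: T_def 1 frame_map_emb JD)
      then show ?thesis using JDX[of "(1, a)"] 1
        by (intro exI[of _ "inverse (c (1, a))"]) (simp add: target_def)
    next
      case 2
      then have "T (v, 1) = (\<kappa> v / (Y v \<bullet> h v)) *\<^sub>R h v" by (simp add: T_def frame_map_U Q_def divide_inverse)
      then show ?thesis using \<kappa>[of v] Y2_pos[OF 2] by (intro exI[of _ "\<kappa> v / (Y v \<bullet> h v)"]) simp
    next
      case 3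
      have "T (v, 1) = \<kappa> (q r) *\<^sub>R Q (q r) + J (D (0, r))" by (simp add: T_def 3 frame_map_lift JD)
      also have "\<dots> = (1 / c (0, r)) *\<^sub>R (Q (q r) + \<rho> r)"
        using JDX[of "(0, r)"] 3 \<kappa>q[OF 3(1)] by (simp add: target_def scaleR_add_right inverse_eq_divide)
      also have "\<dots> = (1 / (c (0, r) * (Y (q r) \<bullet> h v))) *\<^sub>R h v"
        by (simp add: \<rho>_def t_def 3 divide_inverse)
      finally show ?thesis using JDX(2)[of "(0, r)"] 3 Y3_pos[OF 3(1)]
        by (intro exI[of _ "1 / (c (0, r) * (Y (q r) \<bullet> h v))"]) simp
    qed
    then show "\<exists>c>0. T (v, 1) = c *\<^sub>R (V v, 1)" by (simp add: h_def)
  qed fact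
qed

end

subsection \<open>Rigidity of the quartic configuration\<close>

text \<open>Quartic polynomials, by their coefficients in increasing degree, and vectors of the dual space.\<close>

type_synonym quartic = "real \<times> real \<times> real \<times> real \<times> real"

definition mom :: "int \<Rightarrow> quartic" where
  "mom k = (1, of_int k, of_int k ^ 2, of_int k ^ 3, of_int k ^ 4)"

definition axes :: "quartic set" where
  "axes = {(0,1,0,0,0), (0,0,1,0,0), (0,0,0,1,0), (0,0,0,0,1)}"

text \<open>The last eight directions come in pairs \<open>(0,0,0,1,2s)\<close> and \<open>(0,1,s,\<dots>)\<close>; a quartic annihilated by
  both has vanishing first and third derivative at \<open>s/2\<close>, for \<open>s = \<plusminus>2, \<plusminus>3\<close>.\<close>

definition dirs :: "quartic set" where
  "dirs = axes \<union> {(0,1,1,0,0), (0,0,0,1,1), (0,1,0,0,1), (0,0,1,0,1), (0,1,-1,1,1), (0,1,1,0,-1), (0,0,1,1,-1),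
     (0,0,0,1,4), (0,0,0,1,-4), (0,0,0,1,6), (0,0,0,1,-6),
     (0,1,2,4,8), (0,1,-2,4,-8), (0,1,3,7,15), (0,1,-3,7,-15)}"

lemma axes_dirs: "axes \<subseteq> dirs"
  by (auto simp: dirs_def)

lemma dirs_fst: "r \<in> dirs \<Longrightarrow> fst r = 0"
  by (auto simp: dirs_def axes_def)

lemma quartic_eqI:
  fixes f g :: quartic
  assumes "f \<bullet> mom 0 = g \<bullet> mom 0" "\<forall>r\<in>axes. f \<bullet> r = g \<bullet> r"
  shows "f = g"
  using assms unfolding axes_def by (cases f, cases g) (simp add: mom_def)

text \<open>Integrality enters here: the product is negative between its roots, but no integer lies
  there. Hence quartics with roots at consecutive integers can define faces.\<close>

lemma mult_consecutive_nonneg: "0 \<le> of_int k * (of_int k - 1 :: real)"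
proof -
  have "0 \<le> k * (k - 1)" by (cases "k \<le> 0") (auto intro: mult_nonpos_nonpos)
  then have "0 \<le> real_of_int (k * (k - 1))" by linarith
  then show ?thesis by simp
qed

text \<open>The quartics supporting the chain of incidences. Each is a nonnegative combination of
  products of factors \<open>q a\<close> and squares, or uses consecutive integers
  \<open>k^2 + 2 * k - 1\<close> and \<open>k^2 + 2 * k\<close>.\<close>

lemma quartic_nonneg:
  "0 \<le> (0,0,0,-1,1) \<bullet> mom k"
  "0 \<le> (0,-1,0,0,1) \<bullet> mom k"
  "0 \<le> (0,0,-1,0,1) \<bullet> mom k"
  "0 \<le> (0,-1,1,0,0) \<bullet> mom k"
  "0 \<le> (0,0,1,0,1) \<bullet> mom k"
  "0 \<le> (0,-1,2,-1,1) \<bullet> mom k"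
  "0 \<le> (0,2,-1,-2,1) \<bullet> mom k"
  "0 \<le> (0,-2,5,-4,1) \<bullet> mom k"
  "0 \<le> (0,1,1,0,0) \<bullet> mom k"
  "0 \<le> (3,0,-4,0,1) \<bullet> mom k"
  "0 \<le> (0,-2,-1,2,1) \<bullet> mom k"
  "0 \<le> (0,-2,3,4,1) \<bullet> mom k"
  "0 \<le> (0,0,2,3,1) \<bullet> mom k"
  "0 \<le> (0,-1,4,4,1) \<bullet> mom k"
  "0 \<le> (0,4,0,-3,1) \<bullet> mom k"
  "0 \<le> (4,0,-5,0,1) \<bullet> mom k"
proof -
  define x :: real where "x = of_int k"
  define q where "q a = (x - a) * (x - a - 1)" for a
  have nonneg: "0 \<le> q (of_int a)" for a
    using mult_consecutive_nonneg[of "k - a"] by (simp add: q_def x_def)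
  have q: "0 \<le> q 0" "0 \<le> q 1" "0 \<le> q (-1)" "0 \<le> q (-2)"
    using nonneg[of 0] nonneg[of 1] nonneg[of "-1"] nonneg[of "-2"] by simp_all
  have Q: "0 \<le> (x^2 + 2 * x) * (x^2 + 2 * x - 1)"
    using mult_consecutive_nonneg[of "k^2 + 2 * k"] by (simp add: x_def)
  have "(0,0,0,-1,1) \<bullet> mom k = x^2 * q 0"
    by (simp add: mom_def x_def[symmetric] q_def field_simps) algebra?
  then show "0 \<le> (0,0,0,-1,1) \<bullet> mom k" using q Q by simp
  have "(0,-1,0,0,1) \<bullet> mom k = q 0 * (q (-1) + 1)"
    by (simp add: mom_def x_def[symmetric] q_def field_simps) algebra?
  then show "0 \<le> (0,-1,0,0,1) \<bullet> mom k" using q Q by simp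
  have "(0,0,-1,0,1) \<bullet> mom k = q 0 * q (-1)"
    by (simp add: mom_def x_def[symmetric] q_def field_simps) algebra?
  then show "0 \<le> (0,0,-1,0,1) \<bullet> mom k" using q Q by simp
  have "(0,-1,1,0,0) \<bullet> mom k = q 0"
    by (simp add: mom_def x_def[symmetric] q_def field_simps) algebra?
  then show "0 \<le> (0,-1,1,0,0) \<bullet> mom k" using q Q by simp
  have "(0,0,1,0,1) \<bullet> mom k = x^2 + x^4"
    by (simp add: mom_def x_def[symmetric] q_def field_simps) algebra?
  then show "0 \<le> (0,0,1,0,1) \<bullet> mom k" using q Q by simp
  have "(0,-1,2,-1,1) \<bullet> mom k = x^2 * q 0 + q 0 + x^2"
    by (simp add: mom_def x_def[symmetric] q_def field_simps) algebra?
  then show "0 \<le> (0,-1,2,-1,1) \<bullet> mom k" using q Q by simp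
  have "(0,2,-1,-2,1) \<bullet> mom k = q (-1) * q 1"
    by (simp add: mom_def x_def[symmetric] q_def field_simps) algebra?
  then show "0 \<le> (0,2,-1,-2,1) \<bullet> mom k" using q Q by simp
  have "(0,-2,5,-4,1) \<bullet> mom k = q 0 * q 1"
    by (simp add: mom_def x_def[symmetric] q_def field_simps) algebra?
  then show "0 \<le> (0,-2,5,-4,1) \<bullet> mom k" using q Q by simp
  have "(0,1,1,0,0) \<bullet> mom k = q (-1)"
    by (simp add: mom_def x_def[symmetric] q_def field_simps) algebra?
  then show "0 \<le> (0,1,1,0,0) \<bullet> mom k" using q Q by simp
  have "(3,0,-4,0,1) \<bullet> mom k = 2/3 * (q 1 * q (-2)) + 1/3 * (x^2 - 1)^2"
    by (simp add: mom_def x_def[symmetric] q_def field_simps) algebra?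
  then show "0 \<le> (3,0,-4,0,1) \<bullet> mom k" using q Q by simp
  have "(0,-2,-1,2,1) \<bullet> mom k = q 0 * q (-2)"
    by (simp add: mom_def x_def[symmetric] q_def field_simps) algebra?
  then show "0 \<le> (0,-2,-1,2,1) \<bullet> mom k" using q Q by simp
  have "(0,-2,3,4,1) \<bullet> mom k = (x^2 + 2 * x) * (x^2 + 2 * x - 1)"
    by (simp add: mom_def x_def[symmetric] q_def field_simps) algebra?
  then show "0 \<le> (0,-2,3,4,1) \<bullet> mom k" using q Q by simp
  have "(0,0,2,3,1) \<bullet> mom k = x^2 * q (-2)"
    by (simp add: mom_def x_def[symmetric] q_def field_simps) algebra?
  then show "0 \<le> (0,0,2,3,1) \<bullet> mom k" using q Q by simp
  have "(0,-1,4,4,1) \<bullet> mom k = (x^2 + 2 * x) * (x^2 + 2 * x - 1) + q (-1)"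
    by (simp add: mom_def x_def[symmetric] q_def field_simps) algebra?
  then show "0 \<le> (0,-1,4,4,1) \<bullet> mom k" using q Q by simp
  have "(0,4,0,-3,1) \<bullet> mom k = q (-1) * (x - 2)^2"
    by (simp add: mom_def x_def[symmetric] q_def field_simps) algebra?
  then show "0 \<le> (0,4,0,-3,1) \<bullet> mom k" using q Q by simp
  have "(4,0,-5,0,1) \<bullet> mom k = q 1 * q (-2)"
    by (simp add: mom_def x_def[symmetric] q_def field_simps) algebra?
  then show "0 \<le> (4,0,-5,0,1) \<bullet> mom k" using q Q by simp
qed

text \<open>\<open>X\<close> is a realization after normalization: \<open>mom 0\<close>,
  \<open>mom 1\<close> and the four axes form a projective frame of the five-dimensional space.
  \<open>signs\<close> says that every face of the configuration is a face of the
  realization.\<close>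

locale rigid_quartic =
  fixes M :: int and X :: "quartic \<Rightarrow> quartic"
  assumes M: "3 \<le> M"
    and signs: "\<And>f. (\<forall>k. \<bar>k\<bar> \<le> M \<longrightarrow> 0 \<le> f \<bullet> mom k) \<Longrightarrow>
      \<exists>g. \<forall>x \<in> mom ` {-M..M} \<union> dirs. sgn (g \<bullet> X x) = sgn (f \<bullet> x)"
    and frame0: "\<exists>c>0. X (mom 0) = c *\<^sub>R mom 0"
    and frame1: "\<exists>c>0. X (mom 1) = c *\<^sub>R mom 1"
    and frame_dirs: "\<And>r. r \<in> axes \<Longrightarrow> \<exists>c>0. X r = c *\<^sub>R r"
begin

section \<open>Rules for forced functionals and forced vectors\<close>

abbreviation "config \<equiv> mom ` {-M..M} \<union> dirs"

definition known :: "quartic \<Rightarrow> bool" where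
  "known x \<longleftrightarrow> x \<in> config \<and> (\<exists>c>0. X x = c *\<^sub>R x)"

text \<open>If \<open>fixed f\<close>, then the face functional belonging to \<open>f\<close> is forced to be \<open>f\<close> itself.\<close>

definition fixed :: "quartic \<Rightarrow> bool" where
  "fixed f \<longleftrightarrow> (\<forall>x\<in>config. f \<bullet> x = 0 \<longrightarrow> f \<bullet> X x = 0)"

text \<open>The counterpart on directions alone, which also serves quartics that are negative at
  some points.\<close>

definition dfixed :: "quartic \<Rightarrow> bool" where
  "dfixed f \<longleftrightarrow> (\<forall>x\<in>dirs. f \<bullet> x = 0 \<longrightarrow> f \<bullet> X x = 0)"

lemma mom_config: "\<bar>k\<bar> \<le> M \<Longrightarrow> mom k \<in> config"
  by (intro UnI1 imageI) (simp add: abs_le_iff)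

lemma known_frame: "known (mom 0)" "known (mom 1)" "r \<in> axes \<Longrightarrow> known r"
  using frame0 frame1 frame_dirs M axes_dirs by (auto simp: known_def)

lemma known_sgn:
  assumes "known x" "sgn (g \<bullet> X x) = sgn (f \<bullet> x)"
  shows "sgn (g \<bullet> x) = sgn (f \<bullet> x)"
proof -
  obtain c where "c > 0" "X x = c *\<^sub>R x" using assms by (auto simp: known_def)
  then show ?thesis using assms(2) by (simp add: sgn_mult)
qed

lemma known_functional:
  assumes "\<And>x. x \<in> D \<Longrightarrow> sgn (g \<bullet> X x) = sgn (f \<bullet> x)" "known x" "x \<in> D"
  shows "g \<bullet> x = 0 \<longleftrightarrow> f \<bullet> x = 0"
  using known_sgn[OF assms(2) assms(1)[OF assms(3)]] by (metis sgn_0_0)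

lemma functional_multiple:
  assumes g: "\<And>x. x \<in> D \<Longrightarrow> sgn (g \<bullet> X x) = sgn (f \<bullet> x)"
    and geq: "g = t *\<^sub>R f" and nz: "z \<in> D" "f \<bullet> z \<noteq> 0"
    and x: "x \<in> D" "f \<bullet> x = 0"
  shows "f \<bullet> X x = 0"
proof -
  have "t \<noteq> 0" using g[OF nz(1)] nz(2) geq by (auto simp: sgn_zero_iff)
  moreover have "g \<bullet> X x = 0" using g[OF x(1)] x(2) by (simp add: sgn_zero_iff)
  ultimately show ?thesis by (simp add: geq)
qed

text \<open>The functional of the face cut out by \<open>f\<close> vanishes at the known zeros in
  \<open>Z\<close>, and these leave only multiples of \<open>f\<close>. The vector \<open>p\<close>
  reads off the multiple, so \<open>p \<bullet> f = 1\<close>.\<close>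

lemma fixedI:
  assumes nonneg: "\<And>k. 0 \<le> f \<bullet> mom k" and "f \<noteq> 0"
    and known: "\<And>x. x \<in> Z \<Longrightarrow> known x \<and> f \<bullet> x = 0"
    and unique: "\<And>g. (\<forall>x\<in>Z. g \<bullet> x = 0) \<Longrightarrow> g = (p \<bullet> g) *\<^sub>R f"
  shows "fixed f"
proof -
  obtain g where g: "\<And>x. x \<in> config \<Longrightarrow> sgn (g \<bullet> X x) = sgn (f \<bullet> x)"
    using signs[of f] nonneg by blast
  have "g \<bullet> x = 0" if "x \<in> Z" for x
    using known_functional[of config g f x] g known[OF that] unfolding known_def by blast
  then have geq: "g = (p \<bullet> g) *\<^sub>R f" by (intro unique) auto
  have "\<exists>z\<in>config. f \<bullet> z \<noteq> 0"
  proof (rule ccontr)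
    assume *: "\<not> (\<exists>z\<in>config. f \<bullet> z \<noteq> 0)"
    have "f \<bullet> mom 0 = 0" using * mom_config[of 0] M by force
    moreover have "\<forall>r\<in>axes. f \<bullet> r = 0" using * axes_dirs by blast
    ultimately show False using quartic_eqI[of f 0] \<open>f \<noteq> 0\<close> by simp
  qed
  then show ?thesis
    unfolding fixed_def using functional_multiple[OF g geq] by blast
qed

text \<open>The constant quartic 1 is positive on points and zero on directions. The frame forces
  its functional to be a positive multiple of the first coordinate, so directions stay at
  infinity.\<close>

lemma fst_X:
  assumes "x \<in> config"
  shows "sgn (fst (X x)) = sgn (fst x)"
proof -
  obtain g where g: "\<And>x. x \<in> config \<Longrightarrow> sgn (g \<bullet> X x) = sgn ((1,0) \<bullet> x)"
  proof -
    have "0 \<le> (1,0) \<bullet> mom k" for k by (simp add: mom_def)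
    then show ?thesis using signs[of "(1,0)"] that by blast
  qed
  have "sgn (g \<bullet> x) = sgn ((1,0) \<bullet> x)" if "known x" for x
    using known_sgn[OF that g] that by (auto simp: known_def)
  note g_known = this
  have axis: "(c, 0) \<bullet> r = 0" if "r \<in> axes" for c r
    using that dirs_fst[of r] axes_dirs by (cases r) (auto simp: inner_prod_def)
  have "g = (fst g, 0)"
  proof (intro quartic_eqI ballI)
    fix r assume r: "r \<in> axes"
    have "sgn (g \<bullet> r) = 0" using g_known[OF known_frame(3)[OF r]] axis[OF r] by simp
    then show "g \<bullet> r = (fst g, 0) \<bullet> r" using axis[OF r] by (simp add: sgn_zero_iff)
  qed (simp add: mom_def inner_prod_def zero_prod_def)
  moreover have "fst g > 0" using g_known[OF known_frame(1)]
    by (auto simp: mom_def inner_prod_def sgn_1_pos zero_prod_def)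
  ultimately show ?thesis using g[OF assms]
    by (cases g, cases "X x", cases x) (auto simp: inner_prod_def zero_prod_def sgn_mult)
qed

lemma dir_functional:
  obtains g where "fst g = 0" "\<And>r. r \<in> dirs \<Longrightarrow> sgn (g \<bullet> X r) = sgn (h \<bullet> r)"
proof -
  define C where "C = (\<Sum>k\<in>{-M..M}. \<bar>h \<bullet> mom k\<bar>)"
  have "0 \<le> (h + (C,0)) \<bullet> mom k" if "\<bar>k\<bar> \<le> M" for k
  proof -
    have "\<bar>h \<bullet> mom k\<bar> \<le> C" unfolding C_def using that by (intro member_le_sum) auto
    then show ?thesis by (simp add: inner_add_left mom_def)
  qed
  then obtain g where g: "\<And>x. x \<in> config \<Longrightarrow> sgn (g \<bullet> X x) = sgn ((h + (C,0)) \<bullet> x)"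
    using signs[of "h + (C,0)"] by blast
  show thesis
  proof (rule that[of "(0, snd g)"])
    fix r assume r: "r \<in> dirs"
    then have "fst r = 0" "fst (X r) = 0" using dirs_fst[of r] fst_X[of r] by (auto simp: sgn_zero_iff)
    then show "sgn ((0, snd g) \<bullet> X r) = sgn (h \<bullet> r)"
      using g[of r] r by (simp add: inner_prod_def)
  qed simp
qed

lemma dfixedI:
  assumes known: "\<And>x. x \<in> Z \<Longrightarrow> known x \<and> x \<in> dirs \<and> f \<bullet> x = 0"
    and unique: "\<And>g. fst g = 0 \<Longrightarrow> (\<forall>x\<in>Z. g \<bullet> x = 0) \<Longrightarrow> g = (p \<bullet> g) *\<^sub>R f"
    and f: "f \<noteq> 0" "fst f = 0"
  shows "dfixed f"
proof -
  obtain g where g: "fst g = 0" "\<And>r. r \<in> dirs \<Longrightarrow> sgn (g \<bullet> X r) = sgn (f \<bullet> r)"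
    using dir_functional by blast
  have "g \<bullet> x = 0" if "x \<in> Z" for x
    using known_functional[of dirs g f x] g(2) known[OF that] by blast
  then have geq: "g = (p \<bullet> g) *\<^sub>R f" using g(1) by (intro unique) auto
  have "f \<bullet> mom 0 = 0" using f(2) by (simp add: mom_def inner_prod_def zero_prod_def)
  then have "\<exists>z\<in>dirs. f \<bullet> z \<noteq> 0"
    using quartic_eqI[of f 0] f axes_dirs by (metis inner_zero_left subsetD)
  then show ?thesis
    unfolding dfixed_def using functional_multiple[OF g(2) geq] by blast
qed

text \<open>Its signs on the four axes determine the functional of \<open>e\<close> up to a positive
  factor; so \<open>X r\<close> has the sign pattern of \<open>r\<close>.\<close>

lemma axis_X:
  assumes "r \<in> dirs" and e: "e \<in> axes"
  shows "sgn (e \<bullet> X r) = sgn (e \<bullet> r)"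
proof -
  obtain g where g: "fst g = 0" "\<And>x. x \<in> dirs \<Longrightarrow> sgn (g \<bullet> X x) = sgn (e \<bullet> x)"
    using dir_functional[of e] by blast
  have "sgn (g \<bullet> x) = sgn (e \<bullet> x)" if "x \<in> axes" for x
    using known_sgn[OF known_frame(3)] g(2) that axes_dirs by blast
  then have "\<forall>x\<in>axes. sgn (g \<bullet> x) = sgn (e \<bullet> x)" by blast
  then have "g = (e \<bullet> g) *\<^sub>R e \<and> e \<bullet> g > 0" using e g(1) unfolding axes_def
    by (elim insertE; simp; cases g; simp add: sgn_zero_iff sgn_1_pos)
  then obtain c where "g = c *\<^sub>R e" "c > 0" by blast
  with g(2)[OF assms(1)] show ?thesis by (simp add: sgn_mult)
qed

lemma dfixed_if_fixed: "fixed f \<Longrightarrow> dfixed f"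
  by (simp add: fixed_def dfixed_def)

lemma dfixed_axis: "e \<in> axes \<Longrightarrow> dfixed e"
  using axis_X by (metis dfixed_def sgn_0_0)

text \<open>The functionals in \<open>H\<close> leave only the line of \<open>r\<close>, and the
  coordinate \<open>e\<close> shows that the multiple is positive.\<close>

lemma known_dirI:
  assumes r: "r \<in> dirs" "e \<in> axes" "e \<bullet> r = 1"
    and H: "\<And>h. h \<in> H \<Longrightarrow> dfixed h \<and> h \<bullet> r = 0"
    and unique: "\<And>x. fst x = 0 \<Longrightarrow> \<forall>h\<in>H. h \<bullet> x = 0 \<Longrightarrow> x = (e \<bullet> x) *\<^sub>R r"
  shows "known r"
proof -
  have "X r = (e \<bullet> X r) *\<^sub>R r"
    using H r(1) dirs_fst[OF r(1)] fst_X[of r] by (intro unique) (auto simp: dfixed_def sgn_zero_iff)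
  moreover have "e \<bullet> X r > 0" using axis_X[OF r(1,2)] r(3) by (simp add: sgn_1_pos)
  ultimately show ?thesis using r(1) unfolding known_def by blast
qed

lemma known_momI:
  assumes k: "\<bar>k\<bar> \<le> M"
    and H: "\<And>h. h \<in> H \<Longrightarrow> fixed h \<and> h \<bullet> mom k = 0"
    and unique: "\<And>x. \<forall>h\<in>H. h \<bullet> x = 0 \<Longrightarrow> x = fst x *\<^sub>R mom k"
  shows "known (mom k)"
proof -
  note mk = mom_config[OF k]
  have "X (mom k) = fst (X (mom k)) *\<^sub>R mom k"
    using H mk unfolding fixed_def by (intro unique) blast
  moreover have "fst (X (mom k)) > 0"
    using fst_X[OF mk] by (simp add: mom_def sgn_1_pos)
  ultimately show ?thesis using mk unfolding known_def by blast
qed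

text \<open>Four independent known zeros fix a quartic, and enough fixed quartics through a point or direction
  make it known; alternating the two steps leads from the frame to all directions.\<close>

lemma known_base:
  "\<forall>k\<in>{-2,-1,0,1,2}. known (mom k)" "\<forall>r\<in>dirs. known r"
proof -
  note known = known_frame(1,2) known_frame(3)[of "(0,1,0,0,0)"] known_frame(3)[of "(0,0,1,0,0)"]
    known_frame(3)[of "(0,0,0,1,0)"] known_frame(3)[of "(0,0,0,0,1)"]
  note fixed = dfixed_axis[of "(0,1,0,0,0)"] dfixed_axis[of "(0,0,1,0,0)"]
    dfixed_axis[of "(0,0,0,1,0)"] dfixed_axis[of "(0,0,0,0,1)"]
  \<comment> \<open>The frame alone fixes \<open>x^4 - x^3\<close>, and below
    \<open>x^4 - x\<close>, \<open>x^4 - x^2\<close> and \<open>x^2 - x\<close>: each vanishes at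
    the points 0 and 1 and on two axes.\<close>
  have "fixed (0,0,0,-1,1)"
    by (rule fixedI[OF quartic_nonneg(1), where Z = "{mom 0, mom 1, (0,0,1,0,0), (0,1,0,0,0)}" and p = "(0,0,0,0,1)"])
      (use known in \<open>auto simp: mom_def dirs_def axes_def zero_prod_def\<close>)
  note fixed = fixed this dfixed_if_fixed[OF this]
  have "known (0,0,0,1,1)"
    by (rule known_dirI[where H = "{(0,1,0,0,0), (0,0,1,0,0), (0,0,0,-1,1)}" and e = "(0,0,0,1,0)"])
      (use fixed in \<open>auto simp: dirs_def axes_def\<close>)
  note known = known this
  have "fixed (0,-1,0,0,1)"
    by (rule fixedI[OF quartic_nonneg(2), where Z = "{mom 0, mom 1, (0,0,0,1,0), (0,0,1,0,0)}" and p = "(0,0,0,0,1)"])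
      (use known in \<open>auto simp: mom_def dirs_def axes_def zero_prod_def\<close>)
  note fixed = fixed this dfixed_if_fixed[OF this]
  have "known (0,1,0,0,1)"
    by (rule known_dirI[where H = "{(0,0,1,0,0), (0,0,0,1,0), (0,-1,0,0,1)}" and e = "(0,1,0,0,0)"])
      (use fixed in \<open>auto simp: dirs_def axes_def\<close>)
  note known = known this
  have "fixed (0,0,-1,0,1)"
    by (rule fixedI[OF quartic_nonneg(3), where Z = "{mom 0, mom 1, (0,0,0,1,0), (0,1,0,0,0)}" and p = "(0,0,0,0,1)"])
      (use known in \<open>auto simp: mom_def dirs_def axes_def zero_prod_def\<close>)
  note fixed = fixed this dfixed_if_fixed[OF this]
  have "known (0,0,1,0,1)"
    by (rule known_dirI[where H = "{(0,1,0,0,0), (0,0,0,1,0), (0,0,-1,0,1)}" and e = "(0,0,1,0,0)"])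
      (use fixed in \<open>auto simp: dirs_def axes_def\<close>)
  note known = known this
  \<comment> \<open>This quartic is negative at some points, so it is fixed on directions only.
    Three known directions suffice, since the constant coefficient is 0.\<close>
  have "dfixed (0,1,1,1,-1)"
    by (rule dfixedI[where Z = "{(0,0,0,1,1), (0,0,1,0,1), (0,1,0,0,1)}" and p = "(0,0,0,1,0)"])
      (use known in \<open>auto simp: mom_def dirs_def axes_def zero_prod_def\<close>)
  note fixed = fixed this
  have "known (0,1,-1,1,1)"
    by (rule known_dirI[where H = "{(0,0,0,-1,1), (0,-1,0,0,1), (0,1,1,1,-1)}" and e = "(0,1,0,0,0)"])
      (use fixed in \<open>auto simp: dirs_def axes_def\<close>)
  note known = known this
  have "fixed (0,-1,1,0,0)"
    by (rule fixedI[OF quartic_nonneg(4), where Z = "{mom 0, mom 1, (0,0,0,0,1), (0,0,0,1,0)}" and p = "(0,0,1,0,0)"])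
      (use known in \<open>auto simp: mom_def dirs_def axes_def zero_prod_def\<close>)
  note fixed = fixed this dfixed_if_fixed[OF this]
  have "known (0,1,1,0,0)"
    by (rule known_dirI[where H = "{(0,0,0,1,0), (0,0,0,0,1), (0,-1,1,0,0)}" and e = "(0,1,0,0,0)"])
      (use fixed in \<open>auto simp: dirs_def axes_def\<close>)
  note known = known this
  have "fixed (0,0,1,0,1)"
    by (rule fixedI[OF quartic_nonneg(5), where Z = "{mom 0, (0,0,0,1,0), (0,1,-1,1,1), (0,1,0,0,0)}" and p = "(0,0,0,0,1)"])
      (use known in \<open>auto simp: mom_def dirs_def axes_def zero_prod_def\<close>)
  note fixed = fixed this dfixed_if_fixed[OF this]
  have "known (0,1,1,0,-1)"
    by (rule known_dirI[where H = "{(0,0,0,1,0), (0,-1,1,0,0), (0,0,1,0,1)}" and e = "(0,1,0,0,0)"])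
      (use fixed in \<open>auto simp: dirs_def axes_def\<close>)
  note known = known this
  have "dfixed (0,2,-1,-4,1)"
    by (rule dfixedI[where Z = "{(0,0,1,0,1), (0,1,-1,1,1), (0,1,1,0,-1)}" and p = "(0,0,0,0,1)"])
      (use known in \<open>auto simp: mom_def dirs_def axes_def zero_prod_def\<close>)
  note fixed = fixed this
  \<comment> \<open>The first of the eight symmetry directions, for \<open>s = 2\<close>.\<close>
  have "known (0,0,0,1,4)"
    by (rule known_dirI[where H = "{(0,1,0,0,0), (0,0,1,0,0), (0,2,-1,-4,1)}" and e = "(0,0,0,1,0)"])
      (use fixed in \<open>auto simp: dirs_def axes_def\<close>)
  note known = known this
  have "fixed (0,-1,2,-1,1)"
    by (rule fixedI[OF quartic_nonneg(6), where Z = "{mom 0, (0,0,0,1,1), (0,1,0,0,1), (0,1,1,0,-1)}" and p = "(0,0,0,0,1)"])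
      (use known in \<open>auto simp: mom_def dirs_def axes_def zero_prod_def\<close>)
  note fixed = fixed this dfixed_if_fixed[OF this]
  have "known (0,0,1,1,-1)"
    by (rule known_dirI[where H = "{(0,1,0,0,0), (0,0,1,0,1), (0,-1,2,-1,1)}" and e = "(0,0,1,0,0)"])
      (use fixed in \<open>auto simp: dirs_def axes_def\<close>)
  note known = known this
  have "dfixed (0,2,1,-1,0)"
    by (rule dfixedI[where Z = "{(0,0,0,0,1), (0,0,1,1,-1), (0,1,-1,1,1)}" and p = "(0,0,1,0,0)"])
      (use known in \<open>auto simp: mom_def dirs_def axes_def zero_prod_def\<close>)
  note fixed = fixed this
  have "fixed (0,2,-1,-2,1)"
    by (rule fixedI[OF quartic_nonneg(7), where Z = "{mom 0, mom 1, (0,0,1,0,1), (0,1,1,0,-1)}" and p = "(0,0,0,0,1)"])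
      (use known in \<open>auto simp: mom_def dirs_def axes_def zero_prod_def\<close>)
  note fixed = fixed this dfixed_if_fixed[OF this]
  have "fixed (0,-2,5,-4,1)"
    by (rule fixedI[OF quartic_nonneg(8), where Z = "{mom 0, mom 1, (0,0,0,1,4), (0,0,1,1,-1)}" and p = "(0,0,0,0,1)"])
      (use known in \<open>auto simp: mom_def dirs_def axes_def zero_prod_def\<close>)
  note fixed = fixed this dfixed_if_fixed[OF this]
  have "known (0,1,2,4,8)"
    by (rule known_dirI[where H = "{(0,2,1,-1,0), (0,2,-1,-2,1), (0,-2,5,-4,1)}" and e = "(0,1,0,0,0)"])
      (use fixed in \<open>auto simp: dirs_def axes_def\<close>)
  note known = known this
  have "fixed (0,1,1,0,0)"
    by (rule fixedI[OF quartic_nonneg(9), where Z = "{mom 0, (0,0,0,0,1), (0,0,0,1,0), (0,1,-1,1,1)}" and p = "(0,0,1,0,0)"])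
      (use known in \<open>auto simp: mom_def dirs_def axes_def zero_prod_def\<close>)
  note fixed = fixed this dfixed_if_fixed[OF this]
  have "fixed (3,0,-4,0,1)"
    by (rule fixedI[OF quartic_nonneg(10), where Z = "{mom 1, (0,0,0,1,0), (0,1,0,0,0), (0,1,2,4,8)}" and p = "(0,0,0,0,1)"])
      (use known in \<open>auto simp: mom_def dirs_def axes_def zero_prod_def\<close>)
  note fixed = fixed this dfixed_if_fixed[OF this]
  \<comment> \<open>The first point outside the frame: the four quartics vanish at -1 and leave only
    the line of \<open>mom (-1)\<close>.\<close>
  have "known (mom (-1))"
    by (rule known_momI[where H = "{(0,2,-1,-2,1), (0,0,-1,0,1), (0,1,1,0,0), (3,0,-4,0,1)}"])
      (use fixed M in \<open>auto simp: mom_def\<close>)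
  note known = known this
  have "dfixed (0,4,0,-1,0)"
    by (rule dfixedI[where Z = "{(0,0,0,0,1), (0,0,1,0,0), (0,1,2,4,8)}" and p = "(0,0,0,-1,0)"])
      (use known in \<open>auto simp: mom_def dirs_def axes_def zero_prod_def\<close>)
  note fixed = fixed this
  have "fixed (0,-2,-1,2,1)"
    by (rule fixedI[OF quartic_nonneg(11), where Z = "{mom (-1), mom 0, mom 1, (0,0,1,1,-1)}" and p = "(0,0,0,0,1)"])
      (use known in \<open>auto simp: mom_def dirs_def axes_def zero_prod_def\<close>)
  note fixed = fixed this dfixed_if_fixed[OF this]
  have "known (0,1,-2,4,-8)"
    by (rule known_dirI[where H = "{(3,0,-4,0,1), (0,4,0,-1,0), (0,-2,-1,2,1)}" and e = "(0,1,0,0,0)"])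
      (use fixed in \<open>auto simp: dirs_def axes_def\<close>)
  note known = known this
  have "fixed (0,-2,3,4,1)"
    by (rule fixedI[OF quartic_nonneg(12), where Z = "{mom 0, (0,1,-2,4,-8), (0,1,-1,1,1), (0,1,1,0,-1)}" and p = "(0,0,0,0,1)"])
      (use known in \<open>auto simp: mom_def dirs_def axes_def zero_prod_def\<close>)
  note fixed = fixed this dfixed_if_fixed[OF this]
  have "known (0,0,0,1,-4)"
    by (rule known_dirI[where H = "{(0,1,0,0,0), (0,0,1,0,0), (0,-2,3,4,1)}" and e = "(0,0,0,1,0)"])
      (use fixed in \<open>auto simp: dirs_def axes_def\<close>)
  note known = known this
  have "fixed (0,0,2,3,1)"
    by (rule fixedI[OF quartic_nonneg(13), where Z = "{mom (-1), mom 0, (0,1,-2,4,-8), (0,1,0,0,0)}" and p = "(0,0,0,0,1)"])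
      (use known in \<open>auto simp: mom_def dirs_def axes_def zero_prod_def\<close>)
  note fixed = fixed this dfixed_if_fixed[OF this]
  have "fixed (0,-1,4,4,1)"
    by (rule fixedI[OF quartic_nonneg(14), where Z = "{mom 0, (0,0,0,1,-4), (0,1,-1,1,1), (0,1,0,0,1)}" and p = "(0,0,0,0,1)"])
      (use known in \<open>auto simp: mom_def dirs_def axes_def zero_prod_def\<close>)
  note fixed = fixed this dfixed_if_fixed[OF this]
  have "known (0,1,-3,7,-15)"
    by (rule known_dirI[where H = "{(0,-2,-1,2,1), (0,0,2,3,1), (0,-1,4,4,1)}" and e = "(0,1,0,0,0)"])
      (use fixed in \<open>auto simp: dirs_def axes_def\<close>)
  note known = known this
  have "dfixed (0,30,1,-6,-1)"
    by (rule dfixedI[where Z = "{(0,0,1,0,1), (0,1,-3,7,-15), (0,1,2,4,8)}" and p = "(0,0,1,0,0)"])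
      (use known in \<open>auto simp: mom_def dirs_def axes_def zero_prod_def\<close>)
  note fixed = fixed this
  have "known (0,0,0,1,-6)"
    by (rule known_dirI[where H = "{(0,1,0,0,0), (0,0,1,0,0), (0,30,1,-6,-1)}" and e = "(0,0,0,1,0)"])
      (use fixed in \<open>auto simp: dirs_def axes_def\<close>)
  note known = known this
  have "fixed (0,4,0,-3,1)"
    by (rule fixedI[OF quartic_nonneg(15), where Z = "{mom (-1), mom 0, (0,0,1,0,0), (0,1,2,4,8)}" and p = "(0,0,0,0,1)"])
      (use known in \<open>auto simp: mom_def dirs_def axes_def zero_prod_def\<close>)
  note fixed = fixed this dfixed_if_fixed[OF this]
  have "fixed (4,0,-5,0,1)"
    by (rule fixedI[OF quartic_nonneg(16), where Z = "{mom (-1), mom 1, (0,0,0,1,0), (0,1,-3,7,-15)}" and p = "(0,0,0,0,1)"])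
      (use known in \<open>auto simp: mom_def dirs_def axes_def zero_prod_def\<close>)
  note fixed = fixed this dfixed_if_fixed[OF this]
  have "known (mom 2)"
    by (rule known_momI[where H = "{(0,-2,5,-4,1), (0,2,-1,-2,1), (0,4,0,-3,1), (4,0,-5,0,1)}"])
      (use fixed M in \<open>auto simp: mom_def\<close>)
  note known = known this
  have "known (mom (-2))"
    by (rule known_momI[where H = "{(4,0,-5,0,1), (0,-2,-1,2,1), (0,0,2,3,1), (0,-2,3,4,1)}"])
      (use fixed M in \<open>auto simp: mom_def\<close>)
  note known = known this
  have "known (0,1,3,7,15)"
    by (rule known_dirI[where H = "{(0,-2,5,-4,1), (0,2,-1,-2,1), (4,0,-5,0,1)}" and e = "(0,1,0,0,0)"])
      (use fixed in \<open>auto simp: dirs_def axes_def\<close>)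
  note known = known this
  have "dfixed (0,30,-1,-6,1)"
    by (rule dfixedI[where Z = "{(0,0,1,0,1), (0,1,-2,4,-8), (0,1,3,7,15)}" and p = "(0,0,0,0,1)"])
      (use known in \<open>auto simp: mom_def dirs_def axes_def zero_prod_def\<close>)
  note fixed = fixed this
  have "known (0,0,0,1,6)"
    by (rule known_dirI[where H = "{(0,1,0,0,0), (0,0,1,0,0), (0,30,-1,-6,1)}" and e = "(0,0,0,1,0)"])
      (use fixed in \<open>auto simp: dirs_def axes_def\<close>)
  note known = known this
  show "\<forall>k\<in>{-2,-1,0,1,2}. known (mom k)" using known by simp
  show "\<forall>r\<in>dirs. known r" using known known_frame(3) by (simp add: dirs_def ball_Un)
qed

end

section \<open>Quartics with two pairs of consecutive roots\<close>

text \<open>The coefficients of the monic quartic with roots \<open>a, s - a, a + 1, s - a - 1\<close>.\<close>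

definition edge :: "int \<Rightarrow> int \<Rightarrow> quartic" where
  "edge s a = (let t = of_int s; A = of_int (a * (s - a)); B = of_int ((a + 1) * (s - a - 1)) in
     (A * B, - t * (A + B), t^2 + A + B, - 2 * t, 1))"

lemma edge_mom: "edge s a \<bullet> mom k = of_int ((k - a) * (k - (s - a)) * ((k - (a + 1)) * (k - (s - a - 1))))"
  by (simp add: edge_def mom_def Let_def) algebra

text \<open>The roots form the consecutive pairs \<open>a\<close>, \<open>a + 1\<close> and
  \<open>s - a - 1\<close>, \<open>s - a\<close>, with no integer inside either. The hypothesis
  keeps the second pair from lying to the right of the first, so the integers split into three
  ranges.\<close>

lemma edge_nonneg:
  assumes "s \<le> 2 * a + 1"
  shows "0 \<le> edge s a \<bullet> mom k"
proof -
  have "0 \<le> (k - a) * (k - (s - a)) * ((k - (a + 1)) * (k - (s - a - 1)))"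
  proof -
    consider "k \<le> s - a - 1" | "s - a \<le> k" "k \<le> a" | "a + 1 \<le> k" by linarith
    then show ?thesis
    proof cases
      case 1 then show ?thesis using assms by (intro mult_nonneg_nonneg mult_nonpos_nonpos) auto
    next
      case 2 then show ?thesis by (intro mult_nonpos_nonpos mult_nonpos_nonneg mult_nonneg_nonpos) (auto intro: mult_nonpos_nonneg mult_nonneg_nonpos)
    next
      case 3 then show ?thesis using assms by (intro mult_nonneg_nonneg) auto
    qed
  qed
  then show ?thesis unfolding edge_mom by linarith
qed

text \<open>A quartic annihilated by the two directions for \<open>s\<close> is symmetric about \<open>s/2\<close>, hence a quadratic
  polynomial in \<open>k * (s - k)\<close>.\<close>

lemma symmetric_quartic_unique:
  fixes g :: quartic
  assumes "g \<bullet> (0,0,0,1,2 * of_int s) = 0"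
    and "g \<bullet> (0,1,of_int s,r3,r4) = 0" "2 * of_int s * r3 - r4 = of_int s ^ 3"
    and "g \<bullet> mom j = 0" "g \<bullet> mom l = 0"
    and j: "j \<in> {a, s - a}" and l: "l \<in> {a + 1, s - a - 1}" and "s \<noteq> 2 * a + 1"
  shows "g = ((0,0,0,0,1) \<bullet> g) *\<^sub>R edge s a"
proof -
  obtain g0 g1 g2 g3 g4 where g: "g = (g0,g1,g2,g3,g4)" by (cases g)
  define t :: real where "t = of_int s"
  define A B where "A = real_of_int (a * (s - a))" and "B = real_of_int ((a + 1) * (s - a - 1))"
  have "A - B = of_int (2 * a + 1 - s)" by (simp add: A_def B_def algebra_simps)
  then have AB: "A - B \<noteq> 0" using \<open>s \<noteq> 2 * a + 1\<close> by (simp only: of_int_eq_0_iff)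
  have g3: "g3 = - 2 * t * g4" using assms(1) by (simp add: g t_def) algebra
  \<comment> \<open>With \<open>g3\<close> substituted, the condition on \<open>r3\<close>,
    \<open>r4\<close> turns the second annihilator into vanishing of the first derivative at
    \<open>s/2\<close>.\<close>
  have g1: "g1 = - t * g2 + t^3 * g4"
  proof -
    have "g1 + t * g2 + r3 * g3 + r4 * g4 = 0" using assms(2) by (simp add: g t_def mult.commute)
    then show ?thesis using assms(3) unfolding g3 t_def[symmetric] by algebra
  qed
  have A: "of_int j * (t - of_int j) = A" using j by (auto simp: A_def t_def)
  have B: "of_int l * (t - of_int l) = B" using l by (auto simp: B_def t_def)
  \<comment> \<open>A quadratic polynomial in \<open>u = k * (s - k)\<close>. The points
    \<open>j\<close> and \<open>l\<close> give the distinct values \<open>A\<close> and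
    \<open>B\<close> of \<open>u\<close>, so it is \<open>g4 * (u - A) * (u - B)\<close>.\<close>
  have q: "g \<bullet> mom k = g4 * (of_int k * (t - of_int k))^2 - (g2 - t^2 * g4) * (of_int k * (t - of_int k)) + g0" for k
    by (simp add: g mom_def g1 g3) algebra
  have A0: "g4 * A^2 - (g2 - t^2 * g4) * A + g0 = 0" using assms(4) unfolding q A .
  have B0: "g4 * B^2 - (g2 - t^2 * g4) * B + g0 = 0" using assms(5) unfolding q B .
  have "(A - B) * (g4 * (A + B) - (g2 - t^2 * g4)) = 0" using A0 B0 by algebra
  then have "g4 * (A + B) - (g2 - t^2 * g4) = 0" using AB by simp
  then have g2: "g2 = g4 * (t^2 + A + B)" by algebra
  have g0: "g0 = g4 * (A * B)" using A0 unfolding g2 by algebra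
  show ?thesis
    unfolding edge_def Let_def t_def[symmetric] A_def[symmetric] B_def[symmetric]
    by (simp add: g g0 g1 g3) (simp add: g2, algebra)
qed

context rigid_quartic
begin

lemma edge_directions:
  assumes "s \<in> {-3,-2,2,3}"
  obtains r3 r4 where "known (0,0,0,1,2 * of_int s)" "known (0,1,of_int s,r3,r4)"
    "2 * of_int s * r3 - r4 = of_int s ^ 3"
proof -
  have "known (0,0,0,1,2 * of_int s)" using known_base(2) assms by (auto simp: dirs_def)
  \<comment> \<open>The cubic condition reads \<open>8 * s - 4 * s = s^3\<close> for
    \<open>s^2 = 4\<close> and \<open>14 * s - 5 * s = s^3\<close> for
    \<open>s^2 = 9\<close>.\<close>
  moreover have "known (0,1,of_int s, if \<bar>s\<bar> = 2 then 4 else 7, if \<bar>s\<bar> = 2 then 4 * of_int s else 5 * of_int s)"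
    using known_base(2) assms by (auto simp: dirs_def)
  ultimately show thesis using assms by (intro that) auto
qed

text \<open>Symmetry is enforced by the two directions, so one known point of each mirror pair
  suffices. The quartic also vanishes at the mirror images, and this is a constraint on points not
  yet known.\<close>

lemma fixed_edge:
  assumes s: "s \<in> {-3,-2,2,3}" "s < 2 * a + 1"
    and "known (mom j)" "j \<in> {a, s - a}" and "known (mom l)" "l \<in> {a + 1, s - a - 1}"
  shows "fixed (edge s a)"
proof -
  obtain r3 r4 where r: "known (0,0,0,1,2 * of_int s)" "known (0,1,of_int s,r3,r4)"
    "2 * of_int s * r3 - r4 = of_int s ^ 3"
    using edge_directions[OF s(1)] by blast
  let ?Z = "{(0,0,0,1,2 * of_int s), (0,1,of_int s,r3,r4), mom j, mom l}"
  show ?thesis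
  proof (rule fixedI[where Z = ?Z and p = "(0,0,0,0,1)"])
    show "0 \<le> edge s a \<bullet> mom k" for k using s by (intro edge_nonneg) simp
    show "edge s a \<noteq> 0" by (simp add: edge_def Let_def zero_prod_def)
    show "known x \<and> edge s a \<bullet> x = 0" if "x \<in> ?Z" for x
    proof -
      have "edge s a \<bullet> (0,0,0,1,2 * of_int s) = 0" by (simp add: edge_def Let_def)
      moreover have "edge s a \<bullet> (0,1,of_int s,r3,r4) = 0"
        using r(3) by (simp add: edge_def Let_def) algebra
      moreover have "edge s a \<bullet> mom j = 0" "edge s a \<bullet> mom l = 0" using assms unfolding edge_mom by auto
      ultimately show ?thesis using that r assms by auto
    qed
    show "g = ((0,0,0,0,1) \<bullet> g) *\<^sub>R edge s a" if "\<forall>x\<in>?Z. g \<bullet> x = 0" for g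
      using that r(3) assms by (intro symmetric_quartic_unique[of g s r3 r4 j l a]) auto
  qed
qed

text \<open>In terms of \<open>u\<close>, the product of a number and its mirror image, the edges
  are \<open>(u - A) * (u - B)\<close> and \<open>(u - A) * (u - C)\<close>. As
  \<open>B \<noteq> C\<close>, they span \<open>u - A\<close> and \<open>u * (u - A)\<close>, and
  the two equations say that these annihilate \<open>x\<close>.\<close>

lemma edge_link:
  assumes "edge s a \<bullet> x = 0" "edge s (a - 1) \<bullet> x = 0" and "k \<in> {a, s - a}" "s < 2 * a"
    and "x = (x0,x1,x2,x3,x4)"
  defines "A \<equiv> of_int (k * (s - k))" and "t \<equiv> of_int s"
  shows "x2 = t * x1 - A * x0" "x4 = 2 * t * x3 + t * A * x1 - (t^2 + A) * x2"
proof -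
  define B where "B = real_of_int ((a + 1) * (s - a - 1))"
  define C where "C = real_of_int ((a - 1) * (s - (a - 1)))"
  have A: "real_of_int (a * (s - a)) = A" using assms(3) by (auto simp: A_def)
  have "B - C = 2 * of_int (s - 2 * a)" by (simp add: B_def C_def algebra_simps)
  moreover have "real_of_int (s - 2 * a) \<noteq> 0" using assms(4) by (simp only: of_int_eq_0_iff)
  ultimately have BC: "B - C \<noteq> 0" by simp
  have B0: "A * B * x0 - t * (A + B) * x1 + (t^2 + A + B) * x2 - 2 * t * x3 + x4 = 0"
    using assms(1) unfolding edge_def Let_def A B_def[symmetric] t_def[symmetric] by (simp add: assms(5) algebra_simps)
  have C0: "A * C * x0 - t * (A + C) * x1 + (t^2 + A + C) * x2 - 2 * t * x3 + x4 = 0"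
    using assms(2) A unfolding edge_def Let_def C_def[symmetric] t_def[symmetric] by (simp add: assms(5) algebra_simps)
  have "(B - C) * (A * x0 - t * x1 + x2) = 0" using B0 C0 by algebra
  then show *: "x2 = t * x1 - A * x0" using BC by simp
  show "x4 = 2 * t * x3 + t * A * x1 - (t^2 + A) * x2" using B0 * by algebra
qed

text \<open>All four quartics vanish at \<open>k\<close>. Comparing the relations for two different
  centres of symmetry shows that the coordinates of \<open>x\<close> are \<open>x0\<close> times the
  powers of \<open>k\<close>.\<close>

lemma known_from_edges:
  assumes k: "\<bar>k\<bar> \<le> M" and s: "s \<noteq> s'"
    and "fixed (edge s a)" "fixed (edge s (a - 1))" "k \<in> {a, s - a}" "s < 2 * a"
    and "fixed (edge s' b)" "fixed (edge s' (b - 1))" "k \<in> {b, s' - b}" "s' < 2 * b"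
  shows "known (mom k)"
proof (rule known_momI[where H = "{edge s a, edge s (a - 1), edge s' b, edge s' (b - 1)}"])
  show "fixed h \<and> h \<bullet> mom k = 0" if "h \<in> {edge s a, edge s (a - 1), edge s' b, edge s' (b - 1)}" for h
    using that assms by (auto simp: edge_mom)
  fix x assume x: "\<forall>h\<in>{edge s a, edge s (a - 1), edge s' b, edge s' (b - 1)}. h \<bullet> x = 0"
  obtain x0 x1 x2 x3 x4 where eq: "x = (x0,x1,x2,x3,x4)" by (cases x)
  define y t t' where "y = real_of_int k" "t = real_of_int s" "t' = real_of_int s'"
  have "t - t' \<noteq> 0" using s by (simp add: y_t_t'_def)
  have 1: "x2 = t * x1 - y * (t - y) * x0" "x4 = 2 * t * x3 + t * (y * (t - y)) * x1 - (t^2 + y * (t - y)) * x2"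
    using edge_link[of s a x k] x assms(5,6) eq by (auto simp: y_t_t'_def)
  have 2: "x2 = t' * x1 - y * (t' - y) * x0" "x4 = 2 * t' * x3 + t' * (y * (t' - y)) * x1 - (t'^2 + y * (t' - y)) * x2"
    using edge_link[of s' b x k] x assms(9,10) eq by (auto simp: y_t_t'_def)
  have "(t - t') * (x1 - y * x0) = 0" using 1(1) 2(1) by algebra
  then have x1: "x1 = y * x0" using \<open>t - t' \<noteq> 0\<close> by simp
  have x2: "x2 = y^2 * x0" using 1(1) unfolding x1 by algebra
  have "(t - t') * (x3 - y^3 * x0) = 0" using 1(2) 2(2) unfolding x1 x2 by algebra
  then have x3: "x3 = y^3 * x0" using \<open>t - t' \<noteq> 0\<close> by simp
  have x4: "x4 = y^4 * x0" using 1(2) unfolding x1 x2 x3 by algebra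
  show "x = fst x *\<^sub>R mom k" by (simp add: eq mom_def x1 x2 x3 x4 y_t_t'_def)
qed (rule k)

lemma known_mom: "\<bar>k\<bar> \<le> M \<Longrightarrow> known (mom k)"
proof -
  have "\<bar>k\<bar> \<le> M \<Longrightarrow> \<bar>k\<bar> \<le> int m + 2 \<Longrightarrow> known (mom k)" for m k
  proof (induction m arbitrary: k)
    case 0
    then have "k \<in> {-2,-1,0,1,2}" by auto
    then show ?case using known_base(1) by blast
  next
    case (Suc m)
    show ?case
    proof (cases "\<bar>k\<bar> \<le> int m + 2")
      case True then show ?thesis using Suc by blast
    next
      case False
      then have IH: "known (mom j)" if "\<bar>j\<bar> \<le> int m + 2" for j
        using Suc.prems that by (intro Suc.IH) auto
      from False consider "k = int m + 3" | "k = - (int m + 3)" using Suc.prems by linarith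
      then show ?thesis
      proof cases
        case 1
        \<comment> \<open>As \<open>s\<close> is at least 2, both \<open>s - k\<close> and
          \<open>s - k - 1\<close> have absolute value at most \<open>m + 2\<close>. The new root
          \<open>k\<close> is replaced by its known mirror image \<open>s - k\<close>.\<close>
        have "fixed (edge s k)" "fixed (edge s (k - 1))" if "s \<in> {2,3}" for s
          using that 1
          by (intro fixed_edge[of s _ "s - k" "s - k - 1"] fixed_edge[of s _ "k - 1" "s - k"] IH; force)+
        then show ?thesis using 1 Suc.prems by (intro known_from_edges[of k 2 3 k k]) auto
      next
        case 2
        \<comment> \<open>The reflected case: with \<open>a = s - k\<close> the new point is the
          smaller member \<open>s - a\<close> of its pair.\<close>
        have "fixed (edge s (s - k))" "fixed (edge s (s - k - 1))" if "s \<in> {-2,-3}" for s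
          using that 2
          by (intro fixed_edge[of s _ "s - k" "s - k + 1"] fixed_edge[of s _ "k + 1" "s - k"] IH; force)+
        note edges = this
        have "k \<le> - 3" using 2 by simp
        then show ?thesis using Suc.prems
          by (intro known_from_edges[of k "-2" "-3" "-2 - k" "-3 - k"] edges) auto
      qed
    qed
  qed
  from this[of k "nat M"] show "\<bar>k\<bar> \<le> M \<Longrightarrow> known (mom k)" using M by simp
qed

end


section \<open>Normalizing the image of the point 1\<close>

fun scale_coords :: "quartic \<Rightarrow> quartic \<Rightarrow> quartic" where
  "scale_coords (a,b,c,d,e) (x,y,z,v,w) = (a * x, b * y, c * z, d * v, e * w)"

lemma linear_scale_coords: "linear (scale_coords a)"
proof
  show "scale_coords a (x + y) = scale_coords a x + scale_coords a y" for x y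
    by (cases a, cases x, cases y) (simp add: algebra_simps)
  show "scale_coords a (r *\<^sub>R x) = r *\<^sub>R scale_coords a x" for r x
    by (cases a, cases x) (simp add: algebra_simps)
qed

text \<open>The image of \<open>mom 1\<close> has positive coordinates. Dividing by them completes
  the frame required by \<open>rigid_quartic\<close>, and the diagonal map with these entries is
  \<open>D\<close>.\<close>

theorem quartic_rigid:
  assumes M: "3 \<le> M"
    and signs: "\<And>f. (\<forall>k. \<bar>k\<bar> \<le> M \<longrightarrow> 0 \<le> f \<bullet> mom k) \<Longrightarrow>
      \<exists>g. \<forall>x \<in> mom ` {-M..M} \<union> dirs. sgn (g \<bullet> X x) = sgn (f \<bullet> x)"
    and frame: "\<And>x. x \<in> insert (mom 0) axes \<Longrightarrow> X x = x"
  shows "\<exists>D. linear D \<and> (\<forall>e \<in> insert (mom 0) axes. \<exists>a>0. D e = a *\<^sub>R e) \<and>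
    (\<forall>x \<in> mom ` {-M..M} \<union> dirs. \<exists>c>0. X x = c *\<^sub>R D x)"
proof -
  obtain a b c d e where X1: "X (mom 1) = (a,b,c,d,e)" by (cases "X (mom 1)")
  let ?C = "mom ` {-M..M} \<union> dirs"
  have sub: "insert (mom 0) (insert (mom 1) axes) \<subseteq> ?C" using M by (auto simp: dirs_def)
  have get: "\<exists>g0 g1 g2 g3 g4. sgn (g0 * a + g1 * b + g2 * c + g3 * d + g4 * e) = sgn (f0 + f1 + f2 + f3 + f4) \<and>
      sgn g0 = sgn f0 \<and> sgn g1 = sgn f1 \<and> sgn g2 = sgn f2 \<and> sgn g3 = sgn f3 \<and> sgn g4 = sgn f4"
    if nonneg: "\<And>k. 0 \<le> (f0,f1,f2,f3,f4) \<bullet> mom k" for f0 f1 f2 f3 f4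
  proof -
    obtain g where "\<forall>x \<in> ?C. sgn (g \<bullet> X x) = sgn ((f0,f1,f2,f3,f4) \<bullet> x)"
      using signs[of "(f0,f1,f2,f3,f4)"] nonneg by blast
    moreover obtain g0 g1 g2 g3 g4 where "g = (g0,g1,g2,g3,g4)" by (cases g)
    ultimately have g: "\<forall>x \<in> ?C. sgn ((g0,g1,g2,g3,g4) \<bullet> X x) = sgn ((f0,f1,f2,f3,f4) \<bullet> x)"
      by simp
    have "\<forall>x\<in>insert (mom 0) axes. sgn ((g0,g1,g2,g3,g4) \<bullet> x) = sgn ((f0,f1,f2,f3,f4) \<bullet> x)"
    proof
      fix x assume x: "x \<in> insert (mom 0) axes"
      then have "x \<in> ?C" using sub by blast
      with g frame[OF x] show "sgn ((g0,g1,g2,g3,g4) \<bullet> x) = sgn ((f0,f1,f2,f3,f4) \<bullet> x)" by metis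
    qed
    moreover have "sgn ((g0,g1,g2,g3,g4) \<bullet> X (mom 1)) = sgn ((f0,f1,f2,f3,f4) \<bullet> mom 1)"
      using g sub by blast
    ultimately have "sgn (g0 * a + g1 * b + g2 * c + g3 * d + g4 * e) = sgn (f0 + f1 + f2 + f3 + f4) \<and>
      sgn g0 = sgn f0 \<and> sgn g1 = sgn f1 \<and> sgn g2 = sgn f2 \<and> sgn g3 = sgn f3 \<and> sgn g4 = sgn f4"
      unfolding X1 by (simp add: axes_def mom_def add.assoc)
    then show ?thesis by blast
  qed
  have a: "a > 0" using get[of 1 0 0 0 0] by (auto simp: mom_def sgn_zero_iff sgn_1_pos zero_less_mult_iff)
  have c: "c > 0" using get[of 0 0 1 0 0] by (auto simp: mom_def sgn_zero_iff sgn_1_pos zero_less_mult_iff)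
  have e: "e > 0" using get[of 0 0 0 0 1] by (auto simp: mom_def sgn_zero_iff sgn_1_pos zero_less_mult_iff)
  \<comment> \<open>\<open>x\<close> and \<open>x^3\<close> change sign, so they define no faces.
    Positivity of \<open>b\<close> and \<open>d\<close> comes from that of \<open>c\<close> and
    \<open>e\<close> through \<open>x^2 - x\<close> and \<open>x^4 - x^3\<close>, which vanish at
    1.\<close>
  have ratio: "v > 0" if "sgn (p * v + q * w) = 0" "p < 0" "q > 0" "w > 0" for p q v w :: real
  proof (rule ccontr)
    assume "\<not> v > 0"
    then have "0 \<le> p * v" "0 < q * w" using that by (auto intro: mult_nonpos_nonpos)
    then show False using that(1) by (simp add: sgn_zero_iff)
  qed
  have b: "b > 0" using get[OF quartic_nonneg(4)] ratio[OF _ _ _ c, of _ b]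
    by (auto simp: sgn_zero_iff sgn_1_pos sgn_1_neg)
  have d: "d > 0" using get[OF quartic_nonneg(1)] ratio[OF _ _ _ e, of _ d]
    by (auto simp: sgn_zero_iff sgn_1_pos sgn_1_neg)
  note pos = a c e
  let ?D = "scale_coords (a,b,c,d,e)" and ?I = "scale_coords (1/a,1/b,1/c,1/d,1/e)"
  have inv: "?D (?I x) = x" for x using pos b d by (cases x) simp
  \<comment> \<open>Rescaling the vectors by \<open>?I\<close> is compensated by rescaling the
    functionals by \<open>?D\<close>, so the sign condition is inherited.\<close>
  have inner: "?D g \<bullet> ?I x = g \<bullet> x" for g x using pos b d by (cases g, cases x) simp
  interpret rigid_quartic M "\<lambda>x. ?I (X x)"
  proof
    fix f assume "\<forall>k. \<bar>k\<bar> \<le> M \<longrightarrow> 0 \<le> f \<bullet> mom k"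
    then obtain g where "\<forall>x \<in> ?C. sgn (g \<bullet> X x) = sgn (f \<bullet> x)" using signs by blast
    then show "\<exists>g. \<forall>x \<in> ?C. sgn (g \<bullet> ?I (X x)) = sgn (f \<bullet> x)"
      by (intro exI[of _ "?D g"]) (simp add: inner)
  next
    show "\<exists>k>0. ?I (X (mom 0)) = k *\<^sub>R mom 0"
      using pos frame[of "mom 0"] by (intro exI[of _ "1/a"]) (simp add: mom_def)
    show "\<exists>k>0. ?I (X (mom 1)) = k *\<^sub>R mom 1"
      using pos b d X1 by (intro exI[of _ 1]) (simp add: mom_def)
    show "\<exists>k>0. ?I (X r) = k *\<^sub>R r" if "r \<in> axes" for r
      using that pos b d frame[of r] unfolding axes_def
      by (elim insertE emptyE) (auto intro: exI[of _ "1/b"] exI[of _ "1/c"] exI[of _ "1/d"] exI[of _ "1/e"])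
  qed (rule M)
  show ?thesis
  proof (intro exI[of _ ?D] conjI ballI linear_scale_coords)
    show "\<exists>k>0. ?D x = k *\<^sub>R x" if "x \<in> insert (mom 0) axes" for x
      using that pos b d unfolding axes_def by (auto simp: mom_def)
    show "\<exists>k>0. X x = k *\<^sub>R ?D x" if "x \<in> ?C" for x
    proof -
      have "known x" using that known_mom known_base(2) by (auto simp: abs_le_iff)
      then obtain k where "k > 0" "?I (X x) = k *\<^sub>R x" unfolding known_def by blast
      then have "X x = k *\<^sub>R ?D x" using inv[of "X x"] linear_cmul[OF linear_scale_coords] by metis
      with \<open>k > 0\<close> show ?thesis by blast
    qed
  qed
qed

subsection \<open>The polytopes\<close>

lemma card_dirs: "card dirs = 19"
  unfolding dirs_def axes_def by simp

lemma axes_Basis: "axes = Pair 0 ` Basis"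
  unfolding axes_def Basis_prod_def by (auto simp: zero_prod_def)

text \<open>The bound 23 provides 4 old coordinates and a new one for each of the 19 directions. The
  vertices are \<open>2 * M + 1\<close> points, 19 lifts and \<open>DIM('a) - 4\<close> basis
  vectors.\<close>

lemma exists_projectively_unique_polytope:
  fixes M :: int
  assumes "3 \<le> M" and "23 \<le> DIM('a::euclidean_space)"
  shows "\<exists>P :: 'a set. polytope P \<and> aff_dim P = DIM('a) \<and>
    card (vertices P) = nat (2 * M + 16) + DIM('a) \<and> projectively_unique P"
proof -
  define A where "A = snd ` mom ` {-M..M}"
  define R where "R = snd ` dirs"
  have dirs: "dirs = {0} \<times> R"
    unfolding R_def using dirs_fst by (force simp: image_iff)
  have mom: "mom ` {-M..M} = {1} \<times> A"
    unfolding A_def by (force simp: mom_def image_iff)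
  have "card R = card dirs" unfolding dirs by (simp add: card_cartesian_product_singleton)
  then have card_R: "card R = 19" by (simp add: card_dirs)
  then have finite_R: "finite R" using card.infinite by force
  have "inj_on (\<lambda>k. snd (mom k)) {-M..M}" by (rule inj_onI) (simp add: mom_def)
  then have card_A: "card A = nat (2 * M + 1)" using assms(1) by (simp add: A_def image_image card_image)
  have "axes \<subseteq> dirs" by (auto simp: dirs_def)
  then have Basis_R: "Basis \<subseteq> R" unfolding axes_Basis dirs by auto
  have "card (Basis :: (real \<times> real \<times> real \<times> real) set) \<le> card (Basis :: 'a set)"
    using assms(2) by simp
  then obtain b :: "real \<times> real \<times> real \<times> real \<Rightarrow> 'a" where b: "inj_on b Basis" "b ` Basis \<subseteq> Basis"
    using card_le_inj[OF finite_Basis finite_Basis] by blast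
  have "card (Basis - b ` Basis) = DIM('a) - 4"
    using b by (simp add: card_Diff_subset card_image)
  then have "card R \<le> card (Basis - b ` Basis)" using card_R assms(2) by simp
  from card_le_inj[OF finite_R finite_Diff[OF finite_Basis] this]
  obtain q :: "real \<times> real \<times> real \<times> real \<Rightarrow> 'a" where q: "inj_on q R" "q ` R \<subseteq> Basis - b ` Basis"
    by blast
  interpret lawrence_extension A R b q
  proof
    show "finite A" by (simp add: A_def)
    have "snd (mom 0) \<in> A" unfolding A_def using assms(1) by (intro imageI) simp
    then show "0 \<in> A" by (simp add: mom_def zero_prod_def)
    have "0 \<notin> dirs" by (simp add: dirs_def axes_def zero_prod_def)
    then show "0 \<notin> R" unfolding dirs by (simp add: zero_prod_def)
    show "\<exists>m n. m + n \<bullet> a = 0 \<and> (\<forall>x\<in>A - {a}. 0 < m + n \<bullet> x)" if a: "a \<in> A" for a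
    proof -
      obtain k where k: "a = snd (mom k)" using a unfolding A_def by blast
      \<comment> \<open>The quadratic \<open>(j - k)^2\<close> vanishes at the point of
        \<open>k\<close> only and is positive at all others.\<close>
      have eq: "of_int k ^ 2 + (- 2 * of_int k, 1, 0, 0) \<bullet> snd (mom j) = of_int (j - k) ^ 2" for j
        by (simp add: mom_def) algebra
      have "0 < of_int k ^ 2 + (- 2 * of_int k, 1, 0, 0) \<bullet> x" if "x \<in> A - {a}" for x
      proof -
        obtain j where "x = snd (mom j)" "j \<noteq> k" using \<open>x \<in> A - {a}\<close> k unfolding A_def by blast
        then show ?thesis by (simp only: eq) simp
      qed
      moreover have "of_int k ^ 2 + (- 2 * of_int k, 1, 0, 0) \<bullet> a = 0" by (simp only: eq k) simp
      ultimately show ?thesis by blast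
    qed
  qed (fact finite_R b q Basis_R)+
  have "projectively_unique (convex hull S)"
  proof (rule projectively_unique_hull)
    fix X :: "quartic \<Rightarrow> quartic"
    assume signs: "\<And>f. (\<forall>a\<in>A. 0 \<le> f \<bullet> (1, a)) \<Longrightarrow> \<exists>g. \<forall>x\<in>{1} \<times> A \<union> {0} \<times> R. sgn (g \<bullet> X x) = sgn (f \<bullet> x)"
      and frame: "X (1, 0) = (1, 0)" "\<And>i. i \<in> Basis \<Longrightarrow> X (0, i) = (0, i)"
    have mom0: "mom 0 = (1, 0)" by (simp add: mom_def zero_prod_def)
    have "\<exists>D. linear D \<and> (\<forall>e \<in> insert (mom 0) axes. \<exists>a>0. D e = a *\<^sub>R e) \<and>
      (\<forall>x \<in> mom ` {-M..M} \<union> dirs. \<exists>c>0. X x = c *\<^sub>R D x)"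
    proof (rule quartic_rigid[OF assms(1)])
      fix f :: quartic assume f: "\<forall>k. \<bar>k\<bar> \<le> M \<longrightarrow> 0 \<le> f \<bullet> mom k"
      have "0 \<le> f \<bullet> (1, a)" if "a \<in> A" for a
      proof -
        have "(1, a) \<in> mom ` {-M..M}" using that mom by simp
        then obtain k where k: "(1, a) = mom k" "k \<in> {-M..M}" by blast
        then have "\<bar>k\<bar> \<le> M" by (simp add: abs_le_iff)
        then show ?thesis using f k(1) by metis
      qed
      then show "\<exists>g. \<forall>x\<in>mom ` {-M..M} \<union> dirs. sgn (g \<bullet> X x) = sgn (f \<bullet> x)"
        unfolding mom dirs by (intro signs) blast
    next
      fix x assume "x \<in> insert (mom 0) axes"
      then consider "x = (1, 0)" | i where "i \<in> Basis" "x = (0, i)" unfolding mom0 axes_Basis by blast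
      then show "X x = x" using frame by cases simp_all
    qed
    then show "\<exists>D. linear D \<and> (\<exists>a>0. D (1, 0) = a *\<^sub>R (1, 0)) \<and> (\<forall>i\<in>Basis. \<exists>a>0. D (0, i) = a *\<^sub>R (0, i)) \<and>
        (\<forall>x\<in>{1} \<times> A \<union> {0} \<times> R. \<exists>c>0. X x = c *\<^sub>R D x)"
      unfolding mom dirs mom0 axes_Basis by blast
  qed
  moreover have "polytope (convex hull S)" using finite_S by (auto simp: polytope_def)
  moreover have "card (vertices (convex hull S)) = nat (2 * M + 16) + DIM('a)"
    using assms by (simp add: vertices_S card_S card_A card_R)
  ultimately show ?thesis using aff_dim_S by blast
qed

theorem theorem2:
  assumes "CARD('d::finite) \<ge> 69"
  shows "\<exists>P :: nat \<Rightarrow> (real ^ 'd) set.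
           (\<forall>n\<ge>1. polytope (P n) \<and> aff_dim (P n) = int CARD('d) \<and>
                   card (vertices (P n)) = 12 * (n + 1) + 60 + CARD('d) \<and>
                   projectively_unique (P n)) \<and>
           (\<forall>m\<ge>1. \<forall>n\<ge>1. m \<noteq> n \<longrightarrow> \<not> combinatorially_equivalent (P m) (P n))"
proof -
  have "\<exists>P :: (real ^ 'd) set. polytope P \<and> aff_dim P = int CARD('d) \<and>
      card (vertices P) = 12 * (n + 1) + 60 + CARD('d) \<and> projectively_unique P" for n :: nat
  proof -
    \<comment> \<open>\<open>M = 28 + 6 * n\<close> solves
      \<open>2 * M + 16 = 12 * (n + 1) + 60\<close>.\<close>
    have "nat (2 * (28 + 6 * int n) + 16) = 12 * (n + 1) + 60" by simp
    then show ?thesis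
      using exists_projectively_unique_polytope[where 'a = "real ^ 'd", of "28 + 6 * int n"] assms by simp
  qed
  then obtain P :: "nat \<Rightarrow> (real ^ 'd) set" where P: "\<And>n. polytope (P n)" "\<And>n. aff_dim (P n) = int CARD('d)"
      "\<And>n. card (vertices (P n)) = 12 * (n + 1) + 60 + CARD('d)" "\<And>n. projectively_unique (P n)"
    by metis
  have "\<not> combinatorially_equivalent (P m) (P n)" if "m \<noteq> n" for m n
    using combinatorially_equivalent_card_vertices[OF P(1,1), of m n] P(3) that by auto
  with P show ?thesis by (intro exI[of _ P]) blast
qed

end
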